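(* Let $X=\mathbb R^n$, let $1<p<2$, let $q$ be given by $\frac1p=\frac12+\frac1q$, and let $\{\lambda_a\}_{a\in\mathbb Z^n}$ be a family of strictly positive numbers. Let $\mathscr L=\ell^2_\lambda(L^p)$ and $\mathscr M=\ell^\infty_\lambda(L^q)$. Let $\mathscr H$ be a Hilbert space and $T:\mathscr H\to\mathscr L$ a linear continuous map. Then there exist a linear continuous map $R:\mathscr H\to L^2(X)$ and a positive function $g\in\mathscr M$ such that $T=g(Q)R$.
   Context: $X=\mathbb R^n$ carries Lebesgue measure. For $a\in\mathbb Z^n$ let $K_a=a+\,]-1/2,1/2]^n$ and let $\chi_a$ be the characteristic function of $K_a$. The Banach space $\mathscr L=\ell^2_\lambda(L^p)$ is the space of (equivalence classes of) measurable complex functions $f$ on $X$ with $\|f\|_{\mathscr L}:=\big(\sum_{a\in\mathbb Z^n}\|\lambda_a\chi_af\|_{L^p}^2\big)^{1/2}<\infty$. The space $\mathscr M=\ell^\infty_\lambda(L^q)$ is the space of (equivalence classes of) measurable complex functions $g$ on $X$ with $\|g\|_{\mathscr M}:=\sup_{a\in\mathbb Z^n}\|\lambda_a\chi_ag\|_{L^q}<\infty$. $g(Q)$ denotes the operator of multiplication by $g$; it maps $L^2(X)$ continuously into $\mathscr L$ for $g\in\mathscr M$. A positive function means $g\ge0$. *)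

theory Defs
  imports "HOL-Analysis.Analysis"
begin

section \<open>Complex vector spaces and complex Hilbert spaces\<close>

class scaleC =
  fixes scaleC :: "complex \<Rightarrow> 'a \<Rightarrow> 'a" (infixr \<open>*\<^sub>C\<close> 75)

class complex_vector = ab_group_add + scaleC +
  assumes scaleC_add_right: "a *\<^sub>C (x + y) = a *\<^sub>C x + a *\<^sub>C y"
    and scaleC_add_left: "(a + b) *\<^sub>C x = a *\<^sub>C x + b *\<^sub>C x"
    and scaleC_scaleC: "a *\<^sub>C (b *\<^sub>C x) = (a * b) *\<^sub>C x"
    and scaleC_one: "1 *\<^sub>C x = x"

text \<open>The inner product is antilinear in its first argument. The class \<^class>\<open>banach\<close>
  supplies completeness and the compatibility of norm, metric and topology; positive definiteness
  of the inner product is contained in \<open>cinner_same\<close>.\<close>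

class chilbert_space = complex_vector + banach +
  fixes cinner :: "'a \<Rightarrow> 'a \<Rightarrow> complex"
  assumes scaleR_scaleC: "r *\<^sub>R x = complex_of_real r *\<^sub>C x"
    and cinner_commute: "cinner x y = cnj (cinner y x)"
    and cinner_add_right: "cinner x (y + z) = cinner x y + cinner x z"
    and cinner_scaleC_right: "cinner x (c *\<^sub>C y) = c * cinner x y"
    and cinner_same: "cinner x x = complex_of_real ((norm x)\<^sup>2)"

global_interpretation complex_vector:
  vector_space "scaleC :: complex \<Rightarrow> 'a \<Rightarrow> 'a :: complex_vector"
  by standard (rule scaleC_add_right scaleC_add_left scaleC_scaleC scaleC_one)+


section \<open>Measurable functions modulo almost everywhere equality\<close>

definition ae_eq :: "(real ^ 'n \<Rightarrow> complex) \<Rightarrow> (real ^ 'n \<Rightarrow> complex) \<Rightarrow> bool" where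
  "ae_eq f g \<longleftrightarrow> f \<in> borel_measurable lebesgue \<and> g \<in> borel_measurable lebesgue \<and>
     (AE x in lebesgue. f x = g x)"

quotient_type (overloaded) 'n L0 = "real ^ ('n :: finite) \<Rightarrow> complex" / partial: ae_eq
proof (rule part_equivpI)
  show "\<exists>f :: real ^ 'n \<Rightarrow> complex. ae_eq f f"
    by (rule exI[of _ "\<lambda>_. 0"]) (simp add: ae_eq_def)
  show "symp (ae_eq :: (real ^ 'n \<Rightarrow> complex) \<Rightarrow> _)"
    by (auto simp: symp_def ae_eq_def)
  show "transp (ae_eq :: (real ^ 'n \<Rightarrow> complex) \<Rightarrow> _)"
    unfolding transp_def ae_eq_def by auto
qed

instantiation L0 :: (finite) "{comm_ring, scaleC}"
begin

lift_definition zero_L0 :: "'a L0" is "\<lambda>_. 0"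
  by (simp add: ae_eq_def)

lift_definition plus_L0 :: "'a L0 \<Rightarrow> 'a L0 \<Rightarrow> 'a L0" is "\<lambda>f g x. f x + g x"
  unfolding ae_eq_def by auto

lift_definition minus_L0 :: "'a L0 \<Rightarrow> 'a L0 \<Rightarrow> 'a L0" is "\<lambda>f g x. f x - g x"
  unfolding ae_eq_def by auto

lift_definition uminus_L0 :: "'a L0 \<Rightarrow> 'a L0" is "\<lambda>f x. - f x"
  unfolding ae_eq_def by auto

lift_definition times_L0 :: "'a L0 \<Rightarrow> 'a L0 \<Rightarrow> 'a L0" is "\<lambda>f g x. f x * g x"
  unfolding ae_eq_def by auto

lift_definition scaleC_L0 :: "complex \<Rightarrow> 'a L0 \<Rightarrow> 'a L0" is "\<lambda>c f x. c * f x"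
  unfolding ae_eq_def by auto

instance
  by standard (transfer; auto simp: ae_eq_def algebra_simps)+

end

instance L0 :: (finite) complex_vector
  by standard (transfer; auto simp: ae_eq_def algebra_simps)+

lift_definition nonneg_L0 :: "'n::finite L0 \<Rightarrow> bool"
  is "\<lambda>f. AE x in lebesgue. f x \<in> \<real>\<^sub>\<ge>\<^sub>0"
proof -
  fix f g :: "real ^ 'n \<Rightarrow> complex"
  assume "ae_eq f g"
  then have *: "AE x in lebesgue. f x = g x" by (simp add: ae_eq_def)
  show "(AE x in lebesgue. f x \<in> \<real>\<^sub>\<ge>\<^sub>0) = (AE x in lebesgue. g x \<in> \<real>\<^sub>\<ge>\<^sub>0)"
    by (rule eventually_subst) (use * in auto)
qed


section \<open>Norms\<close>

text \<open>All norms take values in \<open>[0,\<infinity>]\<close>; the corresponding space consists of the elements of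
  finite norm.\<close>

text \<open>The power \<open>t \<mapsto> t\<^sup>r\<close> on \<open>[0,\<infinity>]\<close> for an exponent \<open>r > 0\<close>.\<close>

definition ennreal_powr :: "ennreal \<Rightarrow> real \<Rightarrow> ennreal" where
  "ennreal_powr t r = (if t = top then top else ennreal (enn2real t powr r))"

lift_definition Lp_norm :: "real \<Rightarrow> 'n::finite L0 \<Rightarrow> ennreal"
  is "\<lambda>p f. ennreal_powr (\<integral>\<^sup>+ x. ennreal (norm (f x) powr p) \<partial>lebesgue) (1 / p)"
proof -
  fix p :: real and f g :: "real ^ 'n \<Rightarrow> complex"
  assume "ae_eq f g"
  then have "AE x in lebesgue. f x = g x" by (simp add: ae_eq_def)
  then have "(\<integral>\<^sup>+ x. ennreal (norm (f x) powr p) \<partial>lebesgue) =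
             (\<integral>\<^sup>+ x. ennreal (norm (g x) powr p) \<partial>lebesgue)"
    by (intro nn_integral_cong_AE) auto
  then show "ennreal_powr (\<integral>\<^sup>+ x. ennreal (norm (f x) powr p) \<partial>lebesgue) (1 / p) =
             ennreal_powr (\<integral>\<^sup>+ x. ennreal (norm (g x) powr p) \<partial>lebesgue) (1 / p)"
    by simp
qed

definition unit_cube :: "int ^ 'n \<Rightarrow> (real ^ 'n) set" where
  "unit_cube a =
     {x. \<forall>i. real_of_int (a $ i) - 1/2 < x $ i \<and> x $ i \<le> real_of_int (a $ i) + 1/2}"

lemma unit_cube_measurable: "unit_cube a \<in> sets lebesgue"
proof -
  have "unit_cube a = (\<Inter>i. {x. real_of_int (a $ i) - 1/2 < x $ i \<and> x $ i \<le> real_of_int (a $ i) + 1/2})"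
    by (auto simp: unit_cube_def)
  also have "\<dots> \<in> sets borel"
    by measurable
  finally show ?thesis by simp
qed

lift_definition chi :: "int ^ 'n \<Rightarrow> 'n::finite L0" is "\<lambda>a x. indicator (unit_cube a) x"
  using unit_cube_measurable by (auto simp: ae_eq_def intro!: borel_measurable_indicator)

definition l2_Lp_norm :: "(int ^ 'n \<Rightarrow> real) \<Rightarrow> real \<Rightarrow> 'n::finite L0 \<Rightarrow> ennreal" where
  "l2_Lp_norm lam p f =
     ennreal_powr (\<Sum>\<^sub>\<infinity>a. (Lp_norm p (complex_of_real (lam a) *\<^sub>C (chi a * f)))\<^sup>2) (1/2)"

definition linf_Lp_norm :: "(int ^ 'n \<Rightarrow> real) \<Rightarrow> real \<Rightarrow> 'n::finite L0 \<Rightarrow> ennreal" where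
  "linf_Lp_norm lam q g = (SUP a. Lp_norm q (complex_of_real (lam a) *\<^sub>C (chi a * g)))"

definition finite_norm_space :: "('n::finite L0 \<Rightarrow> ennreal) \<Rightarrow> 'n L0 set" where
  "finite_norm_space N = {f. N f < top}"

definition continuous_linear_map ::
  "('n::finite L0 \<Rightarrow> ennreal) \<Rightarrow> ('h::chilbert_space \<Rightarrow> 'n L0) \<Rightarrow> bool" where
  "continuous_linear_map N T \<longleftrightarrow>
     range T \<subseteq> finite_norm_space N \<and>
     Vector_Spaces.linear scaleC scaleC T \<and>
     (\<forall>u. ((\<lambda>v. N (T v - T u)) \<longlongrightarrow> 0) (at u))"

end

theory Submission
  imports Defs
begin

text \<open>By Khintchine's inequality on each cube, followed by the power mean inequality and summation
  over the cubes, \<open>\<parallel>(\<Sum>\<bar>T f\<^sub>i\<bar>\<^sup>2)\<^sup>1\<^sup>/\<^sup>2\<parallel>\<^sup>2 \<le> C \<Sum>\<parallel>f\<^sub>i\<parallel>\<^sup>2\<close> in the norm of \<open>\<L>\<close>. As \<open>p < 2\<close>,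
  \<open>F \<mapsto> \<parallel>F\<^sup>1\<^sup>/\<^sup>2\<parallel>\<^sup>2\<close> is concave on positive functions, and its derivative at \<open>F\<close> has the form
  \<open>H \<mapsto> \<integral> H / g\<^sup>2\<close> with \<open>g\<close> in the unit ball of \<open>\<M>\<close>. An almost maximizer \<open>F\<close> among the convex
  combinations of \<open>\<bar>T f\<^sub>1\<bar>\<^sup>2, \<dots>, \<bar>T f\<^sub>m\<bar>\<^sup>2\<close> thus yields \<open>g\<close> with \<open>\<integral> \<bar>T f\<^sub>i\<bar>\<^sup>2 / g\<^sup>2 \<le> C'\<close> for the
  finitely many unit vectors \<open>f\<^sub>i\<close>. The admissible \<open>g\<close> form a directed family of bounded convex sets,
  closed under almost everywhere convergence by Fatou's lemma, so a limit of almost minimizers of a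
  weighted \<open>L\<^sup>2\<close> norm is admissible for all \<open>f\<close>. A fixed positive summand added to the functions keeps
  all quotients finite and the limit \<open>g\<close> positive; then \<open>R f = T f / g\<close>. The weights \<open>\<lambda>\<^sub>a\<close> are absorbed
  into \<open>T\<close> and \<open>g\<close>.\<close>

subsection \<open>Khintchine's inequality\<close>

text \<open>A subset of the index set encodes a pattern of signs, so averages over random signs
  become finite sums over \<open>Pow A\<close>.\<close>

definition signs :: "'i set \<Rightarrow> 'i \<Rightarrow> real" where
  "signs S i = (if i \<in> S then 1 else - 1)"

definition signed_sum :: "'i set \<Rightarrow> 'i set \<Rightarrow> ('i \<Rightarrow> 'v::real_vector) \<Rightarrow> 'v" where
  "signed_sum A S x = (\<Sum>i\<in>A. signs S i *\<^sub>R x i)"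

text \<open>Sorts the sign patterns by the sign of the new index \<open>a\<close>. This is the
  induction step for the second and the fourth moment of signed sums.\<close>

lemma sum_signed_sum_insert:
  fixes x :: "'i \<Rightarrow> 'v::real_vector" and h :: "'v \<Rightarrow> 'w::comm_monoid_add"
  assumes "finite A" "a \<notin> A"
  shows "(\<Sum>S\<in>Pow (insert a A). h (signed_sum (insert a A) S x)) =
    (\<Sum>S\<in>Pow A. h (signed_sum A S x + x a) + h (signed_sum A S x - x a))"
proof -
  have 1: "signed_sum (insert a A) S x = signed_sum A S x - x a" if "S \<in> Pow A" for S
    using that assms by (auto simp: signed_sum_def signs_def)
  have 2: "signed_sum (insert a A) (insert a S) x = signed_sum A S x + x a" for S
  proof -
    have "(\<Sum>i\<in>A. signs (insert a S) i *\<^sub>R x i) = signed_sum A S x"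
      unfolding signed_sum_def using assms by (intro sum.cong) (auto simp: signs_def)
    then show ?thesis
      using assms by (simp add: signed_sum_def signs_def)
  qed
  have inj: "inj_on (insert a) (Pow A)"
    using assms by (auto simp: inj_on_def)
  have "(\<Sum>S\<in>Pow (insert a A). h (signed_sum (insert a A) S x)) =
      (\<Sum>S\<in>Pow A. h (signed_sum (insert a A) S x)) +
      (\<Sum>S\<in>insert a ` Pow A. h (signed_sum (insert a A) S x))"
    unfolding Pow_insert using assms by (intro sum.union_disjoint) auto
  also have "\<dots> = (\<Sum>S\<in>Pow A. h (signed_sum A S x - x a)) + (\<Sum>S\<in>Pow A. h (signed_sum A S x + x a))"
    unfolding sum.reindex[OF inj] o_def 2
    by (intro arg_cong2[where f="(+)"] sum.cong refl) (simp add: 1)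
  finally show ?thesis
    by (simp add: sum.distrib add.commute)
qed

text \<open>The mixed terms cancel between the two signs of each new summand. The parallelogram law
  is an assumption because the lemma serves both for complex values of functions and for the Hilbert
  space, whose class \<open>chilbert_space\<close> is not built on
  \<open>real_inner\<close>.\<close>

lemma sum_signed_sum_norm2:
  fixes x :: "'i \<Rightarrow> 'v::real_normed_vector"
  assumes "\<And>u v :: 'v. (norm (u + v))\<^sup>2 + (norm (u - v))\<^sup>2 = 2 * (norm u)\<^sup>2 + 2 * (norm v)\<^sup>2"
    and "finite A"
  shows "(\<Sum>S\<in>Pow A. (norm (signed_sum A S x))\<^sup>2) = 2 ^ card A * (\<Sum>i\<in>A. (norm (x i))\<^sup>2)"
  using assms(2)
proof induction
  case empty
  then show ?case by (simp add: signed_sum_def)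
next
  case (insert a A)
  have "(\<Sum>S\<in>Pow (insert a A). (norm (signed_sum (insert a A) S x))\<^sup>2) =
      (\<Sum>S\<in>Pow A. 2 * (norm (signed_sum A S x))\<^sup>2 + 2 * (norm (x a))\<^sup>2)"
    by (simp only: sum_signed_sum_insert[OF insert(1,2), where h="\<lambda>v. (norm v)\<^sup>2"] assms(1))
  also have "\<dots> = 2 * (2 ^ card A * (\<Sum>i\<in>A. (norm (x i))\<^sup>2)) + 2 * 2 ^ card A * (norm (x a))\<^sup>2"
    using insert by (simp add: sum.distrib card_Pow flip: sum_distrib_left)
  finally show ?case
    using insert(1,2) by (simp add: algebra_simps)
qed

lemma norm_parallelogram:
  fixes u v :: "'v::real_inner"
  shows "(norm (u + v))\<^sup>2 + (norm (u - v))\<^sup>2 = 2 * (norm u)\<^sup>2 + 2 * (norm v)\<^sup>2"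
  by (simp add: power2_norm_eq_inner inner_add inner_diff inner_commute)

text \<open>With \<open>s\<close> the sum of the squared norms and \<open>t\<close> the inner
  product, the two fourth powers are the squares of \<open>s + 2 * t\<close> and
  \<open>s - 2 * t\<close>. The terms linear in \<open>t\<close> cancel, and
  \<open>t\<^sup>2\<close> is bounded by Cauchy-Schwarz.\<close>

lemma norm4_add_diff_le:
  fixes u v :: "'v::real_inner"
  shows "(norm (u + v))^4 + (norm (u - v))^4 \<le> 2 * (norm u)^4 + 12 * (norm u)\<^sup>2 * (norm v)\<^sup>2 + 2 * (norm v)^4"
proof -
  define s where "s = (norm u)\<^sup>2 + (norm v)\<^sup>2"
  define t where "t = inner u v"
  have 1: "(norm (u + v))^4 = (s + 2 * t)\<^sup>2" "(norm (u - v))^4 = (s - 2 * t)\<^sup>2"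
  proof -
    have "(norm (u + v))\<^sup>2 = s + 2 * t" "(norm (u - v))\<^sup>2 = s - 2 * t"
      by (simp_all add: s_def t_def power2_norm_eq_inner inner_add inner_diff inner_commute)
    then show "(norm (u + v))^4 = (s + 2 * t)\<^sup>2" "(norm (u - v))^4 = (s - 2 * t)\<^sup>2"
      by (metis power4_eq_xxxx power2_eq_square mult.assoc)+
  qed
  have t: "t\<^sup>2 \<le> (norm u)\<^sup>2 * (norm v)\<^sup>2"
    unfolding t_def power2_norm_eq_inner by (rule Cauchy_Schwarz_ineq)
  have "(s + 2 * t)\<^sup>2 + (s - 2 * t)\<^sup>2 = 2 * s\<^sup>2 + 8 * t\<^sup>2"
    by (simp add: power2_eq_square algebra_simps)
  also have "\<dots> \<le> 2 * s\<^sup>2 + 8 * ((norm u)\<^sup>2 * (norm v)\<^sup>2)"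
    using t by simp
  also have "\<dots> = 2 * (norm u)^4 + 12 * (norm u)\<^sup>2 * (norm v)\<^sup>2 + 2 * (norm v)^4"
    unfolding s_def by (simp add: power2_eq_square power4_eq_xxxx algebra_simps)
  finally show ?thesis unfolding 1 .
qed

lemma sum_signed_sum_norm4_le:
  fixes x :: "'i \<Rightarrow> 'v::real_inner"
  assumes "finite A"
  shows "(\<Sum>S\<in>Pow A. (norm (signed_sum A S x))^4) \<le> 3 * 2 ^ card A * (\<Sum>i\<in>A. (norm (x i))\<^sup>2)\<^sup>2"
  using assms
proof induction
  case empty
  then show ?case by (simp add: signed_sum_def)
next
  case (insert a A)
  define Q where "Q = (\<Sum>i\<in>A. (norm (x i))\<^sup>2)"
  define m where "m = (norm (x a))\<^sup>2"
  define K :: real where "K = 2 ^ card A"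
  have K: "K \<ge> 0" by (simp add: K_def)
  have m4: "(norm (x a))^4 = m\<^sup>2"
    by (simp add: m_def)
  have "(\<Sum>S\<in>Pow (insert a A). (norm (signed_sum (insert a A) S x))^4) =
     (\<Sum>S\<in>Pow A. (norm (signed_sum A S x + x a))^4 + (norm (signed_sum A S x - x a))^4)"
    using insert by (intro sum_signed_sum_insert[where h="\<lambda>v. (norm v)^4"])
  also have "\<dots> \<le> (\<Sum>S\<in>Pow A. 2 * (norm (signed_sum A S x))^4 + 12 * (norm (signed_sum A S x))\<^sup>2 * (norm (x a))\<^sup>2 + 2 * (norm (x a))^4)"
    by (intro sum_mono norm4_add_diff_le)
  also have "\<dots> = 2 * (\<Sum>S\<in>Pow A. (norm (signed_sum A S x))^4) + 12 * m * (\<Sum>S\<in>Pow A. (norm (signed_sum A S x))\<^sup>2) + 2 * K * m\<^sup>2"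
    using insert(1) unfolding m4 m_def[symmetric]
    by (simp add: sum.distrib sum_distrib_left K_def card_Pow algebra_simps)
  also have "\<dots> \<le> 2 * (3 * K * Q\<^sup>2) + 12 * m * (K * Q) + 2 * K * m\<^sup>2"
    using insert.IH insert(1) sum_signed_sum_norm2[OF norm_parallelogram insert(1), of x]
    by (simp add: K_def Q_def)
  \<comment> \<open>The mixed terms \<open>12 * K * m * Q\<close> agree on both sides, which is what
    fixes the constant 3; the only slack is in the coefficient of \<open>m\<^sup>2\<close>.\<close>
  also have "\<dots> \<le> 3 * (2 * K) * (m + Q)\<^sup>2"
    using K mult_nonneg_nonneg[OF K zero_le_power2[of m]] by (simp add: power2_eq_square algebra_simps)
  finally show ?case
    using insert(1,2) by (simp add: K_def Q_def m_def)
qed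

text \<open>The lower bound for the \<open>p\<close>-th moment follows from the second and fourth moments through the
  pointwise inequality \<open>z\<^sup>2 \<le> 6 \<sigma>\<^sup>2\<^sup>-\<^sup>p z\<^sup>p + z\<^sup>4 / (6 \<sigma>\<^sup>2)\<close>.\<close>

lemma Khintchine_lower:
  fixes x :: "'i \<Rightarrow> 'v::real_inner"
  assumes p: "0 < p" "p < 2" and A: "finite A"
  shows "(\<Sum>i\<in>A. (norm (x i))\<^sup>2) powr (p / 2) \<le>
    12 / 2 ^ card A * (\<Sum>S\<in>Pow A. norm (signed_sum A S x) powr p)"
proof -
  define Q where "Q = (\<Sum>i\<in>A. (norm (x i))\<^sup>2)"
  define K :: real where "K = 2 ^ card A"
  define P where "P = (\<Sum>S\<in>Pow A. norm (signed_sum A S x) powr p)"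
  have K: "K > 0" by (simp add: K_def)
  have P: "P \<ge> 0" unfolding P_def by (intro sum_nonneg) auto
  have "Q powr (p / 2) \<le> 12 / K * P"
  proof (cases "Q = 0")
    case True
    then show ?thesis using P K by simp
  next
    case False
    then have Q: "Q > 0"
      unfolding Q_def by (metis sum_nonneg zero_le_power2 order_le_less)
    define \<sigma> where "\<sigma> = sqrt Q"
    have \<sigma>: "\<sigma> > 0" "\<sigma>\<^sup>2 = Q" using Q by (auto simp: \<sigma>_def)
    have pw: "z\<^sup>2 \<le> 6 * \<sigma> powr (2 - p) * z powr p + z^4 / (6 * Q)" if z: "z \<ge> 0" for z
    proof (cases "z \<le> sqrt 6 * \<sigma>")
      case le: True
      show ?thesis
      proof (cases "z = 0")
        case False
        then have z0: "z > 0" using z by simp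
        have "z\<^sup>2 = z powr (2 - p) * z powr p"
          using z0 by (simp flip: powr_add)
        also have "\<dots> \<le> (sqrt 6 * \<sigma>) powr (2 - p) * z powr p"
          using le z0 p by (intro mult_right_mono powr_mono2) auto
        also have "\<dots> = sqrt 6 powr (2 - p) * \<sigma> powr (2 - p) * z powr p"
          using \<sigma> by (simp add: powr_mult)
        also have "\<dots> \<le> sqrt 6 powr 2 * \<sigma> powr (2 - p) * z powr p"
          using p by (intro mult_right_mono powr_mono) auto
        also have "\<dots> = 6 * \<sigma> powr (2 - p) * z powr p" by simp
        finally show ?thesis using Q by (simp add: add_increasing2)
      qed simp
    next
      case False
      then have "(sqrt 6 * \<sigma>)\<^sup>2 \<le> z\<^sup>2"
        using \<sigma> by (intro power_mono) auto
      then have "6 * Q \<le> z\<^sup>2" using \<sigma> by (simp add: power_mult_distrib)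
      then have "z\<^sup>2 * (6 * Q) \<le> z\<^sup>2 * z\<^sup>2" by (intro mult_left_mono) auto
      then have "z\<^sup>2 \<le> z^4 / (6 * Q)"
        using Q by (simp add: field_simps power2_eq_square power4_eq_xxxx)
      moreover have "0 \<le> 6 * \<sigma> powr (2 - p) * z powr p" by simp
      ultimately show ?thesis by linarith
    qed
    have "K * Q = (\<Sum>S\<in>Pow A. (norm (signed_sum A S x))\<^sup>2)"
      unfolding K_def Q_def by (rule sum_signed_sum_norm2[OF norm_parallelogram A, symmetric])
    also have "\<dots> \<le> (\<Sum>S\<in>Pow A. 6 * \<sigma> powr (2 - p) * norm (signed_sum A S x) powr p
        + (norm (signed_sum A S x))^4 / (6 * Q))"
      by (intro sum_mono pw) auto
    also have "\<dots> = 6 * \<sigma> powr (2 - p) * P + (\<Sum>S\<in>Pow A. (norm (signed_sum A S x))^4) / (6 * Q)"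
      by (simp add: P_def sum.distrib sum_distrib_left sum_divide_distrib)
    also have "\<dots> \<le> 6 * \<sigma> powr (2 - p) * P + (3 * K * Q\<^sup>2) / (6 * Q)"
      using sum_signed_sum_norm4_le[OF A, of x] Q unfolding K_def Q_def
      by (intro add_left_mono divide_right_mono) auto
    \<comment> \<open>The 6 in \<open>pw\<close> is twice the constant 3 of the fourth moment, so
      this term is half of \<open>K * Q\<close> and is absorbed by the left-hand side.\<close>
    also have "(3 * K * Q\<^sup>2) / (6 * Q) = K * Q / 2"
      using Q by (simp add: power2_eq_square)
    finally have "K * Q \<le> 12 * \<sigma> powr (2 - p) * P" by simp
    moreover have "Q = \<sigma> powr (2 - p) * Q powr (p / 2)"
    proof -
      have "Q powr (p / 2) = \<sigma> powr p"
        using Q by (simp add: \<sigma>_def powr_half_sqrt[symmetric] powr_powr)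
      then show ?thesis using \<sigma> by (simp flip: powr_add)
    qed
    ultimately have "\<sigma> powr (2 - p) * (K * Q powr (p / 2)) \<le> \<sigma> powr (2 - p) * (12 * P)"
      by (simp add: mult_ac)
    then have "K * Q powr (p / 2) \<le> 12 * P"
      using \<sigma> by (subst (asm) mult_le_cancel_left_pos) auto
    then show ?thesis using K by (simp add: field_simps)
  qed
  then show ?thesis by (simp add: Q_def K_def P_def)
qed

subsection \<open>Cell norms and the square function estimate\<close>

lemma ennreal_powr_ennreal: "0 \<le> x \<Longrightarrow> ennreal_powr (ennreal x) s = ennreal (x powr s)"
  by (simp add: ennreal_powr_def)

lemma ennreal_powr_top [simp]: "ennreal_powr top s = top"
  by (simp add: ennreal_powr_def)

lemma ennreal_powr_eq_top_iff [simp]: "ennreal_powr t s = top \<longleftrightarrow> t = top"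
  by (simp add: ennreal_powr_def)

lemma ennreal_powr_mono:
  assumes "0 \<le> s" "t \<le> u" shows "ennreal_powr t s \<le> ennreal_powr u s"
proof (cases "u = top")
  case False
  then have "t \<noteq> top" using assms(2) top.extremum_unique by blast
  with False assms show ?thesis
    by (simp add: ennreal_powr_def less_top[symmetric] enn2real_mono powr_mono2 ennreal_leI)
qed simp

lemma ennreal_powr_cmult:
  assumes "0 < c" shows "ennreal_powr (ennreal c * t) s = ennreal (c powr s) * ennreal_powr t s"
proof (cases t)
  case (real x)
  then show ?thesis
    using assms by (simp add: ennreal_powr_ennreal powr_mult flip: ennreal_mult)
next
  case top
  then show ?thesis using assms by (simp add: ennreal_mult_top)
qed

text \<open>Young's inequality bounds each \<open>y i * m powr (s - 1)\<close>, with
  \<open>m\<close> the mean, by \<open>y i powr s / s + m powr s / q\<close>. Averaging gives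
  \<open>m powr s\<close> on the left, and the last summand is absorbed there.\<close>

lemma powr_mean_le:
  fixes y :: "'i \<Rightarrow> real"
  assumes s: "1 < s" and P: "finite P" "P \<noteq> {}" and y: "\<And>i. i \<in> P \<Longrightarrow> 0 \<le> y i"
  shows "(\<Sum>i\<in>P. y i / card P) powr s \<le> (\<Sum>i\<in>P. y i powr s / card P)"
proof -
  define m where "m = (\<Sum>i\<in>P. y i / card P)"
  have n: "real (card P) > 0" using P by (simp add: card_gt_0_iff)
  have m0: "m \<ge> 0" unfolding m_def using y by (intro sum_nonneg) auto
  define q where "q = s / (s - 1)"
  have q: "q > 1" "1 / s + 1 / q = 1"
    using s by (auto simp: q_def field_simps)
  have mq: "(m powr (s - 1)) powr q = m powr s"
    using s by (simp add: powr_powr q_def)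
  have "m powr s = m * m powr (s - 1)"
    using m0 s by (cases "m = 0") (auto simp: powr_diff)
  also have "\<dots> = (\<Sum>i\<in>P. y i * m powr (s - 1) / card P)"
    unfolding m_def by (simp add: sum_distrib_right)
  also have "\<dots> \<le> (\<Sum>i\<in>P. (y i powr s / s + m powr s / q) / card P)"
    using Youngs_inequality[OF s q(1) q(2), of _ "m powr (s - 1)"] y n
    by (intro sum_mono divide_right_mono) (auto simp: mq)
  also have "\<dots> = (\<Sum>i\<in>P. y i powr s / card P) / s + m powr s / q"
  proof -
    have "(\<Sum>i\<in>P. y i powr s / s / card P) = (\<Sum>i\<in>P. y i powr s / card P) / s"
      unfolding sum_divide_distrib by (intro sum.cong) auto
    then show ?thesis using n by (simp add: sum.distrib add_divide_distrib)
  qed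
  finally have "m powr s * (1 - 1 / q) \<le> (\<Sum>i\<in>P. y i powr s / card P) / s"
    by (simp add: algebra_simps)
  moreover have *: "1 - 1 / q = 1 / s" using q by simp
  ultimately have "m powr s / s \<le> (\<Sum>i\<in>P. y i powr s / card P) / s"
    unfolding * by simp
  then show ?thesis
    using s by (simp add: m_def divide_right_mono_neg divide_le_cancel)
qed

lemma ennreal_powr_mean_le:
  assumes s: "1 < s" and P: "finite P" "P \<noteq> {}"
  shows "ennreal_powr (\<Sum>i\<in>P. ennreal (1 / card P) * Y i) s \<le> (\<Sum>i\<in>P. ennreal (1 / card P) * ennreal_powr (Y i) s)"
proof (cases "\<exists>i\<in>P. Y i = top")
  case True
  then obtain i where "i \<in> P" "Y i = top" by blast
  have "ennreal (1 / card P) * ennreal_powr (Y i) s = top"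
    using P \<open>Y i = top\<close> by (simp add: ennreal_mult_top card_gt_0_iff)
  then have "(\<Sum>i\<in>P. ennreal (1 / card P) * ennreal_powr (Y i) s) = top"
    using P \<open>i \<in> P\<close> by (auto simp: ennreal_sum_eq_top)
  then show ?thesis by simp
next
  case False
  define y where "y i = enn2real (Y i)" for i
  have Y: "Y i = ennreal (y i)" "0 \<le> y i" if "i \<in> P" for i
    using False that by (auto simp: y_def less_top[symmetric])
  have "(\<Sum>i\<in>P. ennreal (1 / card P) * Y i) = (\<Sum>i\<in>P. ennreal (y i / card P))"
    by (intro sum.cong refl) (simp add: Y flip: ennreal_mult)
  also have "\<dots> = ennreal (\<Sum>i\<in>P. y i / card P)"
    using Y by (intro sum_ennreal) auto
  finally have 1: "ennreal_powr (\<Sum>i\<in>P. ennreal (1 / card P) * Y i) s = ennreal ((\<Sum>i\<in>P. y i / card P) powr s)"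
    using Y by (simp add: ennreal_powr_ennreal sum_nonneg)
  have "(\<Sum>i\<in>P. ennreal (1 / card P) * ennreal_powr (Y i) s) = (\<Sum>i\<in>P. ennreal (y i powr s / card P))"
    by (intro sum.cong refl) (simp add: Y ennreal_powr_ennreal flip: ennreal_mult)
  also have "\<dots> = ennreal (\<Sum>i\<in>P. y i powr s / card P)"
    using Y by (intro sum_ennreal) auto
  finally show ?thesis
    unfolding 1 using powr_mean_le[OF s P, of y] Y by (simp add: ennreal_leI)
qed

lemma ennreal_powr_add_le:
  assumes s: "1 < s"
  shows "ennreal_powr (t + u) s \<le> ennreal (2 powr s) * (ennreal_powr t s + ennreal_powr u s)"
proof -
  have "t + u \<le> ennreal 2 * max t u"
    by (simp add: mult_2 add_mono)
  then have "ennreal_powr (t + u) s \<le> ennreal_powr (ennreal 2 * max t u) s"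
    using s by (intro ennreal_powr_mono) auto
  also have "\<dots> = ennreal (2 powr s) * ennreal_powr (max t u) s"
    by (rule ennreal_powr_cmult) simp
  also have "\<dots> \<le> ennreal (2 powr s) * (ennreal_powr t s + ennreal_powr u s)"
    by (intro mult_left_mono) (auto simp: max_def add_increasing add_increasing2)
  finally show ?thesis .
qed

text \<open>Abstract form of the partition into unit cubes: \<open>k\<close> sends a point to the
  index of its cell. Weights do not occur here; they are later multiplied into the
  functions.\<close>

locale cells =
  fixes M :: "'b measure" and k :: "'b \<Rightarrow> 'a::countable"
  assumes measurable_k [measurable]: "k \<in> M \<rightarrow>\<^sub>M count_space UNIV"
    and emeasure_cell: "\<And>a. emeasure M (k -` {a} \<inter> space M) = 1"
begin

definition cell_int :: "('b \<Rightarrow> ennreal) \<Rightarrow> 'a \<Rightarrow> ennreal" where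
  "cell_int f a = (\<integral>\<^sup>+ x. f x * indicator (k -` {a}) x \<partial>M)"

text \<open>For nonnegative \<open>F\<close> this is the quasinorm of l^1(L^r). With
  \<open>r = p / 2\<close> and \<open>F\<close> the squared modulus of \<open>f\<close> it is the
  square of the unweighted l^2(L^p) norm of \<open>f\<close>.\<close>

definition cell_norm :: "real \<Rightarrow> ('b \<Rightarrow> real) \<Rightarrow> ennreal" where
  "cell_norm r F =
    (\<integral>\<^sup>+ a. ennreal_powr (cell_int (\<lambda>x. ennreal (F x powr r)) a) (1 / r) \<partial>count_space UNIV)"

lemma measurable_indicator_cell [measurable]:
  "(\<lambda>x. indicator (k -` {a}) x :: ennreal) \<in> borel_measurable M"
proof -
  have "(\<lambda>x. indicator {a} (k x) :: ennreal) \<in> borel_measurable M" by measurable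
  then show ?thesis by (simp add: indicator_def)
qed

lemma cell_int_mono_AE: "AE x in M. f x \<le> g x \<Longrightarrow> cell_int f a \<le> cell_int g a"
  unfolding cell_int_def by (intro nn_integral_mono_AE) (auto elim!: eventually_mono simp: indicator_def)

lemma cell_int_cong: "(\<And>x. k x = a \<Longrightarrow> f x = g x) \<Longrightarrow> cell_int f a = cell_int g a"
  unfolding cell_int_def by (intro nn_integral_cong) (auto simp: indicator_def)

lemma cell_int_mono: "(\<And>x. k x = a \<Longrightarrow> f x \<le> g x) \<Longrightarrow> cell_int f a \<le> cell_int g a"
  unfolding cell_int_def by (intro nn_integral_mono) (auto simp: indicator_def)

lemma cell_int_cmult: "f \<in> borel_measurable M \<Longrightarrow> cell_int (\<lambda>x. c * f x) a = c * cell_int f a"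
  unfolding cell_int_def by (simp add: nn_integral_cmult mult.assoc)

lemma cell_int_add:
  "f \<in> borel_measurable M \<Longrightarrow> g \<in> borel_measurable M \<Longrightarrow>
    cell_int (\<lambda>x. f x + g x) a = cell_int f a + cell_int g a"
  unfolding cell_int_def by (simp add: nn_integral_add distrib_right)

lemma cell_int_sum:
  "(\<And>i. i \<in> P \<Longrightarrow> f i \<in> borel_measurable M) \<Longrightarrow>
    cell_int (\<lambda>x. \<Sum>i\<in>P. f i x) a = (\<Sum>i\<in>P. cell_int (f i) a)"
  unfolding cell_int_def by (simp add: nn_integral_sum sum_distrib_right)

lemma cell_int_const: "cell_int (\<lambda>_. c) a = c"
proof -
  have "cell_int (\<lambda>_. c) a = c * (\<integral>\<^sup>+ x. indicator (k -` {a} \<inter> space M) x \<partial>M)"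
    unfolding cell_int_def
    by (subst nn_integral_cmult[symmetric]) (auto intro!: nn_integral_cong simp: indicator_def)
  also have "\<dots> = c"
    using emeasure_cell by (subst nn_integral_indicator) auto
  finally show ?thesis .
qed

text \<open>The cells partition the space, so this is countable additivity of the measure with
  density \<open>f\<close>.\<close>

lemma nn_integral_cell_int:
  assumes [measurable]: "f \<in> borel_measurable M"
  shows "(\<integral>\<^sup>+ a. cell_int f a \<partial>count_space UNIV) = (\<integral>\<^sup>+ x. f x \<partial>M)"
proof -
  have "(\<integral>\<^sup>+ a. cell_int f a \<partial>count_space UNIV) =
      (\<integral>\<^sup>+ a. emeasure (density M f) (k -` {a} \<inter> space M) \<partial>count_space UNIV)"
    by (intro nn_integral_cong)
       (auto simp: cell_int_def emeasure_density indicator_def intro!: nn_integral_cong)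
  also have "\<dots> = emeasure (density M f) (\<Union>a\<in>UNIV. k -` {a} \<inter> space M)"
    by (intro emeasure_UN_countable[symmetric]) (auto simp: disjoint_family_on_def)
  also have "(\<Union>a\<in>UNIV. k -` {a} \<inter> space M) = space M" by auto
  also have "emeasure (density M f) (space M) = (\<integral>\<^sup>+ x. f x \<partial>M)"
    by (auto simp: emeasure_density intro!: nn_integral_cong)
  finally show ?thesis .
qed

lemma cell_norm_mono_AE:
  assumes "0 < r" "AE x in M. 0 \<le> F x \<and> F x \<le> G x"
  shows "cell_norm r F \<le> cell_norm r G"
  unfolding cell_norm_def
proof (intro nn_integral_mono ennreal_powr_mono cell_int_mono_AE)
  show "AE x in M. ennreal (F x powr r) \<le> ennreal (G x powr r)"
    using assms(2) by eventually_elim (use assms(1) in \<open>auto intro!: ennreal_leI powr_mono2\<close>)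
qed (use assms in auto)

text \<open>For \<open>r < 1\<close> there is only a quasi-triangle inequality. The inner power is
  subadditive, since \<open>v \<le> v powr r\<close> on the unit interval; the outer power
  \<open>1 / r > 1\<close> costs the constant.\<close>

lemma cell_norm_add_le:
  assumes r: "0 < r" "r < 1"
    and [measurable]: "F \<in> borel_measurable M" "G \<in> borel_measurable M"
    and nn: "\<And>x. 0 \<le> F x" "\<And>x. 0 \<le> G x"
  shows "cell_norm r (\<lambda>x. F x + G x) \<le> ennreal (2 powr (1 / r)) * (cell_norm r F + cell_norm r G)"
proof -
  let ?I = "\<lambda>F. cell_int (\<lambda>x. ennreal (F x powr r))"
  have pw: "(s + t) powr r \<le> s powr r + t powr r" if "0 \<le> s" "0 \<le> t" for s t :: real
  proof (cases "s = 0 \<or> t = 0")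
    case False
    then have st: "0 < s" "0 < t" using that by auto
    have *: "v powr r \<ge> v" if "0 < v" "v \<le> 1" for v
      using that r powr_mono'[of r 1 v] by simp
    have "1 = s / (s + t) + t / (s + t)" using st by (simp flip: add_divide_distrib)
    also have "\<dots> \<le> (s / (s + t)) powr r + (t / (s + t)) powr r"
      using st by (intro add_mono *) auto
    also have "\<dots> = (s powr r + t powr r) / (s + t) powr r"
      using st by (simp add: powr_divide add_divide_distrib)
    finally show ?thesis using st by (simp add: field_simps)
  qed auto
  have "?I (\<lambda>x. F x + G x) a \<le> ?I F a + ?I G a" for a
    using pw nn by (subst cell_int_add[symmetric]) (auto intro!: cell_int_mono simp flip: ennreal_plus)
  then have "cell_norm r (\<lambda>x. F x + G x) \<le>
     (\<integral>\<^sup>+ a. ennreal (2 powr (1 / r)) * (ennreal_powr (?I F a) (1 / r) + ennreal_powr (?I G a) (1 / r)) \<partial>count_space UNIV)"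
    unfolding cell_norm_def using r
    by (intro nn_integral_mono order.trans[OF ennreal_powr_mono ennreal_powr_add_le]) auto
  also have "\<dots> = ennreal (2 powr (1 / r)) * (cell_norm r F + cell_norm r G)"
    unfolding cell_norm_def by (simp add: nn_integral_cmult nn_integral_add)
  finally show ?thesis .
qed

end

text \<open>The exceptional null set depends on the vectors involved, so linearity is available for
  finitely many vectors at a time.\<close>

lemma AE_linear_sum:
  fixes X :: "'h::real_vector \<Rightarrow> 'b \<Rightarrow> 'v::real_vector"
  assumes add: "\<And>u v. AE x in M. X (u + v) x = X u x + X v x"
    and scale: "\<And>c u. AE x in M. X (c *\<^sub>R u) x = c *\<^sub>R X u x"
    and "finite A"
  shows "AE x in M. X (\<Sum>i\<in>A. c i *\<^sub>R u i) x = (\<Sum>i\<in>A. c i *\<^sub>R X (u i) x)"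
  using \<open>finite A\<close>
proof induction
  case empty
  then show ?case using scale[of 0 0] by simp
next
  case (insert a A)
  show ?case
    using insert.IH add[of "c a *\<^sub>R u a" "\<Sum>i\<in>A. c i *\<^sub>R u i"] scale[of "c a" "u a"]
    by eventually_elim (use insert(1,2) in simp)
qed

context cells
begin

text \<open>Random signs reduce the square function of many vectors to the images of the single
  vectors \<open>v S\<close>, to which the bound \<open>B\<close> applies. The constant depends
  neither on the number of vectors nor on the cells.\<close>

lemma cell_norm_square_function_le:
  fixes X :: "'h::real_normed_vector \<Rightarrow> 'b \<Rightarrow> complex" and u :: "'i \<Rightarrow> 'h"
  assumes r: "0 < r" "r < 1"
    and parallelogram:
      "\<And>u v :: 'h. (norm (u + v))\<^sup>2 + (norm (u - v))\<^sup>2 = 2 * (norm u)\<^sup>2 + 2 * (norm v)\<^sup>2"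
    and meas [measurable]: "\<And>u. X u \<in> borel_measurable M"
    and add: "\<And>u v. AE x in M. X (u + v) x = X u x + X v x"
    and scale: "\<And>c u. AE x in M. X (c *\<^sub>R u) x = c *\<^sub>R X u x"
    and B: "0 \<le> B" "\<And>u. cell_norm r (\<lambda>x. (norm (X u x))\<^sup>2) \<le> ennreal (B * (norm u)\<^sup>2)"
    and A: "finite A"
  shows "cell_norm r (\<lambda>x. \<Sum>i\<in>A. (norm (X (u i) x))\<^sup>2) \<le>
    ennreal (12 powr (1 / r) * B * (\<Sum>i\<in>A. (norm (u i))\<^sup>2))"
proof -
  let ?I = "\<lambda>F. cell_int (\<lambda>x. ennreal (F x powr r))"
  define v where "v S = signed_sum A S u" for S
  define P where "P = Pow A"
  have P: "finite P" "P \<noteq> {}" "card P = 2 ^ card A" using A by (auto simp: P_def card_Pow)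
  have sq: "(norm z)\<^sup>2 powr r = norm z powr (2 * r)" for z :: complex
    by (cases "z = 0") (auto simp: powr_powr simp flip: powr_numeral)
  \<comment> \<open>There are finitely many sign patterns, so a single null set serves for all of
    them.\<close>
  have "AE x in M. \<forall>S\<in>P. X (v S) x = signed_sum A S (\<lambda>i. X (u i) x)"
    unfolding v_def signed_sum_def using P
    by (intro AE_finite_allI AE_linear_sum add scale A) auto
  then have "AE x in M. ennreal ((\<Sum>i\<in>A. (norm (X (u i) x))\<^sup>2) powr r) \<le>
      ennreal 12 * (\<Sum>S\<in>P. ennreal (1 / card P) * ennreal ((norm (X (v S) x))\<^sup>2 powr r))"
  proof eventually_elim
    case (elim x)
    have "(\<Sum>i\<in>A. (norm (X (u i) x))\<^sup>2) powr r \<le>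
        12 / card P * (\<Sum>S\<in>P. norm (signed_sum A S (\<lambda>i. X (u i) x)) powr (2 * r))"
      using Khintchine_lower[of "2 * r" A "\<lambda>i. X (u i) x"] r A P by (simp add: P_def)
    also have "\<dots> = 12 * (\<Sum>S\<in>P. 1 / card P * (norm (X (v S) x))\<^sup>2 powr r)"
      using elim by (simp add: sq sum_distrib_left)
    finally have "ennreal ((\<Sum>i\<in>A. (norm (X (u i) x))\<^sup>2) powr r) \<le>
       ennreal (12 * (\<Sum>S\<in>P. 1 / card P * (norm (X (v S) x))\<^sup>2 powr r))"
      by (rule ennreal_leI)
    also have "\<dots> = ennreal 12 * (\<Sum>S\<in>P. ennreal (1 / card P * (norm (X (v S) x))\<^sup>2 powr r))"
      by (subst ennreal_mult) (auto intro!: sum_nonneg simp: sum_ennreal)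
    also have "\<dots> = ennreal 12 * (\<Sum>S\<in>P. ennreal (1 / card P) * ennreal ((norm (X (v S) x))\<^sup>2 powr r))"
      by (subst ennreal_mult) auto
    finally show ?case .
  qed
  then have "?I (\<lambda>x. \<Sum>i\<in>A. (norm (X (u i) x))\<^sup>2) a \<le>
      cell_int (\<lambda>x. ennreal 12 * (\<Sum>S\<in>P. ennreal (1 / card P) * ennreal ((norm (X (v S) x))\<^sup>2 powr r))) a" for a
    by (rule cell_int_mono_AE)
  also have "\<And>a. cell_int (\<lambda>x. ennreal 12 * (\<Sum>S\<in>P. ennreal (1 / card P) * ennreal ((norm (X (v S) x))\<^sup>2 powr r))) a
     = ennreal 12 * (\<Sum>S\<in>P. ennreal (1 / card P) * ?I (\<lambda>x. (norm (X (v S) x))\<^sup>2) a)"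
    by (subst cell_int_cmult, measurable)
       (subst cell_int_sum, measurable, simp add: cell_int_cmult)
  finally have I: "?I (\<lambda>x. \<Sum>i\<in>A. (norm (X (u i) x))\<^sup>2) a \<le>
      ennreal 12 * (\<Sum>S\<in>P. ennreal (1 / card P) * ?I (\<lambda>x. (norm (X (v S) x))\<^sup>2) a)" for a .
  have "ennreal_powr (?I (\<lambda>x. \<Sum>i\<in>A. (norm (X (u i) x))\<^sup>2) a) (1 / r) \<le>
     ennreal (12 powr (1 / r)) * (\<Sum>S\<in>P. ennreal (1 / card P) * ennreal_powr (?I (\<lambda>x. (norm (X (v S) x))\<^sup>2) a) (1 / r))" for a
  proof -
    have "ennreal_powr (?I (\<lambda>x. \<Sum>i\<in>A. (norm (X (u i) x))\<^sup>2) a) (1 / r) \<le>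
       ennreal_powr (ennreal 12 * (\<Sum>S\<in>P. ennreal (1 / card P) * ?I (\<lambda>x. (norm (X (v S) x))\<^sup>2) a)) (1 / r)"
      using r by (intro ennreal_powr_mono I) auto
    also have "\<dots> = ennreal (12 powr (1 / r)) *
        ennreal_powr (\<Sum>S\<in>P. ennreal (1 / card P) * ?I (\<lambda>x. (norm (X (v S) x))\<^sup>2) a) (1 / r)"
      by (rule ennreal_powr_cmult) simp
    \<comment> \<open>Since \<open>1 / r > 1\<close>, the outer power is convex and moves inside the
      average over the sign patterns.\<close>
    also have "\<dots> \<le> ennreal (12 powr (1 / r)) *
        (\<Sum>S\<in>P. ennreal (1 / card P) * ennreal_powr (?I (\<lambda>x. (norm (X (v S) x))\<^sup>2) a) (1 / r))"
      using r P by (intro mult_left_mono ennreal_powr_mean_le) auto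
    finally show ?thesis .
  qed
  then have "cell_norm r (\<lambda>x. \<Sum>i\<in>A. (norm (X (u i) x))\<^sup>2) \<le>
    (\<integral>\<^sup>+ a. ennreal (12 powr (1 / r)) * (\<Sum>S\<in>P. ennreal (1 / card P) * ennreal_powr (?I (\<lambda>x. (norm (X (v S) x))\<^sup>2) a) (1 / r)) \<partial>count_space UNIV)"
    unfolding cell_norm_def by (intro nn_integral_mono)
  also have "\<dots> = ennreal (12 powr (1 / r)) * (\<Sum>S\<in>P. ennreal (1 / card P) * cell_norm r (\<lambda>x. (norm (X (v S) x))\<^sup>2))"
    unfolding cell_norm_def by (simp add: nn_integral_cmult nn_integral_sum)
  also have "\<dots> \<le> ennreal (12 powr (1 / r)) * (\<Sum>S\<in>P. ennreal (1 / card P) * ennreal (B * (norm (v S))\<^sup>2))"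
    by (intro mult_left_mono sum_mono B) auto
  also have "\<dots> = ennreal (12 powr (1 / r)) * (\<Sum>S\<in>P. ennreal (1 / card P * (B * (norm (v S))\<^sup>2)))"
    using B(1) by (subst ennreal_mult) auto
  also have "\<dots> = ennreal (12 powr (1 / r)) * ennreal (\<Sum>S\<in>P. 1 / card P * (B * (norm (v S))\<^sup>2))"
    using B(1) by (subst sum_ennreal) auto
  also have "\<dots> = ennreal (12 powr (1 / r) * (\<Sum>S\<in>P. 1 / card P * (B * (norm (v S))\<^sup>2)))"
    using B(1) by (subst ennreal_mult) (auto intro!: sum_nonneg)
  also have "(\<Sum>S\<in>P. 1 / card P * (B * (norm (v S))\<^sup>2)) = B / card P * (\<Sum>S\<in>Pow A. (norm (signed_sum A S u))\<^sup>2)"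
    by (simp add: sum_distrib_left P_def v_def)
  \<comment> \<open>In the Hilbert space the average of the squared norms of \<open>v S\<close> is
    computed exactly, so that no further constant arises.\<close>
  also have "\<dots> = B * (\<Sum>i\<in>A. (norm (u i))\<^sup>2)"
    unfolding sum_signed_sum_norm2[OF parallelogram A] P(3) by simp
  finally show ?thesis by (simp add: mult_ac)
qed

end

subsection \<open>Supporting weights of the cell norm\<close>

context cells
begin

lemma cell_int_pos:
  assumes [measurable]: "f \<in> borel_measurable M" and f: "\<And>x. 0 < f x"
  shows "0 < cell_int f a"
proof (rule ccontr)
  assume "\<not> 0 < cell_int f a"
  then have "(\<integral>\<^sup>+ x. f x * indicator (k -` {a}) x \<partial>M) = 0"
    by (simp add: cell_int_def)
  then have "AE x in M. f x * indicator (k -` {a}) x = 0"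
    by (subst (asm) nn_integral_0_iff_AE) auto
  then have "AE x in M. (1 :: ennreal) * indicator (k -` {a}) x = 0"
    by eventually_elim (use f in \<open>auto simp: less_le indicator_def\<close>)
  then have "cell_int (\<lambda>_. 1) a = 0"
    unfolding cell_int_def by (subst nn_integral_0_iff_AE) auto
  then show False by (simp add: cell_int_const)
qed

text \<open>Real-valued, so an infinite integral is sent to \<open>0\<close>. Finiteness of
  \<open>cell_norm r G\<close> excludes this case wherever the value is used.\<close>

definition cell_quasinorm :: "real \<Rightarrow> ('b \<Rightarrow> real) \<Rightarrow> 'a \<Rightarrow> real" where
  "cell_quasinorm r G a = enn2real (cell_int (\<lambda>x. ennreal (G x powr r)) a) powr (1 / r)"

text \<open>Density of the derivative of \<open>cell_norm r\<close> at \<open>G\<close>: on a cell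
  with quasinorm \<open>n\<close>, the derivative of the quasinorm in direction \<open>H\<close> is
  the integral of \<open>H * (n / G) powr (1 - r)\<close>.\<close>

definition dual_weight :: "real \<Rightarrow> ('b \<Rightarrow> real) \<Rightarrow> 'b \<Rightarrow> real" where
  "dual_weight r G x = (cell_quasinorm r G (k x) / G x) powr (1 - r)"

lemma measurable_dual_weight [measurable]:
  assumes [measurable]: "G \<in> borel_measurable M"
  shows "dual_weight r G \<in> borel_measurable M"
  unfolding dual_weight_def by measurable

context
  fixes r :: real and G :: "'b \<Rightarrow> real"
  assumes r: "0 < r" "r < 1"
    and G_meas [measurable]: "G \<in> borel_measurable M"
    and G_pos: "\<And>x. 0 < G x"
    and G_fin: "cell_norm r G < top"
begin

lemma cell_int_powr_eq:
  "0 < cell_quasinorm r G a"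
  "cell_int (\<lambda>x. ennreal (G x powr r)) a = ennreal (cell_quasinorm r G a powr r)"
  "ennreal_powr (cell_int (\<lambda>x. ennreal (G x powr r)) a) (1 / r) = ennreal (cell_quasinorm r G a)"
proof -
  let ?I = "cell_int (\<lambda>x. ennreal (G x powr r)) a"
  have "ennreal_powr ?I (1 / r) \<noteq> \<infinity>"
    using nn_integral_noteq_infinite[of "\<lambda>a. ennreal_powr (cell_int (\<lambda>x. ennreal (G x powr r)) a) (1 / r)" "count_space UNIV"] G_fin
    by (simp add: cell_norm_def AE_count_space)
  then have fin: "?I < top" by (simp add: less_top[symmetric])
  moreover have pos: "0 < ?I"
    by (intro cell_int_pos) (use G_pos in \<open>auto simp: ennreal_less_zero_iff less_imp_neq[symmetric]\<close>)
  ultimately obtain i where i: "?I = ennreal i" "0 < i"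
    by (cases ?I) auto
  then show "0 < cell_quasinorm r G a" "?I = ennreal (cell_quasinorm r G a powr r)"
      "ennreal_powr ?I (1 / r) = ennreal (cell_quasinorm r G a)"
    using r by (auto simp: cell_quasinorm_def powr_powr ennreal_powr_ennreal)
qed

lemma dual_weight_pos: "0 < dual_weight r G x"
  using cell_int_powr_eq(1)[of "k x"] G_pos[of x] by (simp add: dual_weight_def)

text \<open>Euler's identity: the functional is homogeneous of degree one, so its derivative at
  \<open>G\<close> applied to \<open>G\<close> returns its value.\<close>

lemma cell_norm_eq_dual_weight: "cell_norm r G = (\<integral>\<^sup>+ x. ennreal (G x * dual_weight r G x) \<partial>M)"
proof -
  have "cell_int (\<lambda>x. ennreal (G x * dual_weight r G x)) a = ennreal (cell_quasinorm r G a)" for a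
  proof -
    let ?n = "cell_quasinorm r G a"
    have n: "?n > 0" by (rule cell_int_powr_eq)
    have "cell_int (\<lambda>x. ennreal (G x * dual_weight r G x)) a =
        cell_int (\<lambda>x. ennreal (?n powr (1 - r)) * ennreal (G x powr r)) a"
    proof (rule cell_int_cong)
      fix x assume "k x = a"
      then have "G x * dual_weight r G x = ?n powr (1 - r) * (G x / G x powr (1 - r))"
        using n G_pos[of x] by (simp add: dual_weight_def powr_divide)
      also have "G x / G x powr (1 - r) = G x powr (1 - (1 - r))"
        using G_pos[of x] by (subst powr_diff) simp
      finally show "ennreal (G x * dual_weight r G x) = ennreal (?n powr (1 - r)) * ennreal (G x powr r)"
        by (simp flip: ennreal_mult)
    qed
    also have "\<dots> = ennreal (?n powr (1 - r)) * ennreal (?n powr r)"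
      by (subst cell_int_cmult, measurable) (simp only: cell_int_powr_eq)
    also have "\<dots> = ennreal ?n"
      using n by (simp flip: ennreal_mult powr_add)
    finally show ?thesis .
  qed
  then have "(\<integral>\<^sup>+ a. cell_int (\<lambda>x. ennreal (G x * dual_weight r G x)) a \<partial>count_space UNIV) = cell_norm r G"
    unfolding cell_norm_def cell_int_powr_eq(3) by simp
  then show ?thesis by (subst (asm) nn_integral_cell_int) auto
qed

text \<open>For \<open>r < 1\<close> the functional is concave and homogeneous, hence lies below its
  tangent at \<open>G\<close>. On each cell this is Hoelder's inequality with exponents
  \<open>1 / r\<close> and \<open>1 / (1 - r)\<close>.\<close>

lemma cell_norm_le_dual_weight:
  assumes [measurable]: "F \<in> borel_measurable M" and F: "\<And>x. 0 < F x"
  shows "cell_norm r F \<le> (\<integral>\<^sup>+ x. ennreal (F x * dual_weight r G x) \<partial>M)"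
proof -
  have "ennreal_powr (cell_int (\<lambda>x. ennreal (F x powr r)) a) (1 / r) \<le>
      cell_int (\<lambda>x. ennreal (F x * dual_weight r G x)) a" for a
  proof (cases "cell_int (\<lambda>x. ennreal (F x * dual_weight r G x)) a = top")
    case False
    let ?w = "dual_weight r G"
    let ?n = "cell_quasinorm r G a"
    have n: "?n > 0" by (rule cell_int_powr_eq)
    have "0 < cell_int (\<lambda>x. ennreal (F x * ?w x)) a"
      using F dual_weight_pos by (intro cell_int_pos) auto
    then obtain A where A: "cell_int (\<lambda>x. ennreal (F x * ?w x)) a = ennreal A" "A > 0"
      using False by (cases "cell_int (\<lambda>x. ennreal (F x * ?w x)) a") auto
    \<comment> \<open>Young's inequality for \<open>F x * ?w x / A\<close> and
      \<open>(G x / ?n) powr r\<close>. Both have integral one over the cell, so the right-hand side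
      integrates to \<open>A powr r\<close>.\<close>
    have pw: "F x powr r \<le> A powr r * (r / A * (F x * ?w x) + (1 - r) / ?n powr r * G x powr r)"
      if "k x = a" for x
    proof -
      have Gx: "G x > 0" "F x > 0" "?w x > 0" using G_pos F dual_weight_pos by auto
      have "(F x * ?w x / A) powr r * ((G x / ?n) powr r) powr (1 - r) \<le>
          r * (F x * ?w x / A) + (1 - r) * (G x / ?n) powr r"
        using r Gx n A by (intro Youngs_inequality_0) auto
      moreover have "?w x powr r * ((G x / ?n) powr r) powr (1 - r) = 1"
      proof -
        have "?w x powr r = (?n / G x) powr (r * (1 - r))"
          using that by (simp add: dual_weight_def powr_powr mult.commute)
        moreover have "((G x / ?n) powr r) powr (1 - r) = (G x / ?n) powr (r * (1 - r))"
          by (simp add: powr_powr)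
        moreover have "(?n / G x) powr (r * (1 - r)) * (G x / ?n) powr (r * (1 - r)) = 1"
          using Gx n by (simp flip: powr_mult)
        ultimately show ?thesis by simp
      qed
      ultimately have "(F x / A) powr r \<le> r * (F x * ?w x / A) + (1 - r) * (G x / ?n) powr r"
        using Gx A by (simp add: powr_mult powr_divide mult_ac)
      then have "F x powr r / A powr r \<le> r / A * (F x * ?w x) + (1 - r) / ?n powr r * G x powr r"
        using Gx A n by (simp add: powr_divide)
      then show ?thesis using A by (simp add: divide_simps mult_ac)
    qed
    have "cell_int (\<lambda>x. ennreal (F x powr r)) a \<le>
        cell_int (\<lambda>x. ennreal (A powr r) * (ennreal (r / A) * ennreal (F x * ?w x) +
          ennreal ((1 - r) / ?n powr r) * ennreal (G x powr r))) a"
    proof (rule cell_int_mono)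
      fix x assume "k x = a"
      have "0 \<le> F x * ?w x" using F[of x] dual_weight_pos[of x] by simp
      moreover have "ennreal (F x powr r) \<le> ennreal (A powr r * (r / A * (F x * ?w x) + (1 - r) / ?n powr r * G x powr r))"
        by (intro ennreal_leI pw) fact
      ultimately show "ennreal (F x powr r) \<le> ennreal (A powr r) * (ennreal (r / A) * ennreal (F x * ?w x) +
          ennreal ((1 - r) / ?n powr r) * ennreal (G x powr r))"
        using r A n by (simp flip: ennreal_mult ennreal_plus)
    qed
    also have "\<dots> = ennreal (A powr r) * (ennreal (r / A) * ennreal A +
          ennreal ((1 - r) / ?n powr r) * ennreal (?n powr r))"
      by (simp add: cell_int_cmult cell_int_add A(1) cell_int_powr_eq(2))
    also have "\<dots> = ennreal (A powr r)"
      using r A n by (simp flip: ennreal_mult ennreal_plus)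
    finally have "ennreal_powr (cell_int (\<lambda>x. ennreal (F x powr r)) a) (1 / r) \<le> ennreal_powr (ennreal (A powr r)) (1 / r)"
      using r by (intro ennreal_powr_mono) auto
    also have "\<dots> = ennreal A"
      using r A by (simp add: ennreal_powr_ennreal powr_powr)
    finally show ?thesis unfolding A .
  qed simp
  then have "cell_norm r F \<le> (\<integral>\<^sup>+ a. cell_int (\<lambda>x. ennreal (F x * dual_weight r G x)) a \<partial>count_space UNIV)"
    unfolding cell_norm_def by (intro nn_integral_mono)
  then show ?thesis by (subst (asm) nn_integral_cell_int) auto
qed

end

lemma cell_quasinorm_scale_le:
  assumes r: "0 < r" "r < 1" and c: "0 < c"
    and [measurable]: "F \<in> borel_measurable M" "G \<in> borel_measurable M"
    and G: "\<And>x. 0 < G x" "cell_norm r G < top" and F: "cell_norm r F < top" "\<And>x. c * G x \<le> F x"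
  shows "c * cell_quasinorm r G a \<le> cell_quasinorm r F a"
proof -
  have pos: "0 < F x" for x
    using F(2)[of x] c G(1)[of x] by (auto intro: less_le_trans[OF mult_pos_pos])
  have "ennreal (c powr r) * cell_int (\<lambda>x. ennreal (G x powr r)) a =
     cell_int (\<lambda>x. ennreal (c powr r) * ennreal (G x powr r)) a"
    by (rule cell_int_cmult[symmetric]) measurable
  also have "\<dots> \<le> cell_int (\<lambda>x. ennreal (F x powr r)) a"
  proof (rule cell_int_mono)
    fix x
    have "(c * G x) powr r \<le> F x powr r"
      using F(2)[of x] c r G(1)[of x] by (intro powr_mono2) auto
    then show "ennreal (c powr r) * ennreal (G x powr r) \<le> ennreal (F x powr r)"
      using c G(1)[of x] by (simp add: powr_mult ennreal_leI flip: ennreal_mult)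
  qed
  finally have "ennreal (c powr r * cell_quasinorm r G a powr r) \<le> ennreal (cell_quasinorm r F a powr r)"
    using r G F pos by (simp add: cell_int_powr_eq(2) ennreal_mult)
  then have "(c * cell_quasinorm r G a) powr r \<le> cell_quasinorm r F a powr r"
    using c cell_int_powr_eq(1)[OF r _ G] by (simp add: powr_mult)
  then show ?thesis
    using r cell_int_powr_eq(1)[OF r _ pos F(1)]
    by (meson assms(4) less_eq_real_def not_less powr_less_mono2)
qed

text \<open>The weight of a function \<open>G\<close> at which the concave functional \<^term>\<open>cell_norm r\<close> is almost
  maximal on the convex set is, up to constants, a supporting functional. Comparability of
  the elements of the set makes this work without the maximum being attained.\<close>

lemma almost_maximizer_weight:
  fixes \<G> :: "('b \<Rightarrow> real) set"
  assumes r: "0 < r" "r < 1" and L: "2 \<le> L" and S0: "0 \<le> S0" and ne: "\<G> \<noteq> {}"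
    and conv: "\<And>G H s. G \<in> \<G> \<Longrightarrow> H \<in> \<G> \<Longrightarrow> 0 \<le> s \<Longrightarrow> s \<le> 1 \<Longrightarrow> (\<lambda>x. (1 - s) * G x + s * H x) \<in> \<G>"
    and comp: "\<And>G H x. G \<in> \<G> \<Longrightarrow> H \<in> \<G> \<Longrightarrow> H x \<le> L * G x"
    and meas: "\<And>G. G \<in> \<G> \<Longrightarrow> G \<in> borel_measurable M"
    and pos: "\<And>G x. G \<in> \<G> \<Longrightarrow> 0 < G x"
    and bound: "\<And>G. G \<in> \<G> \<Longrightarrow> cell_norm r G \<le> ennreal S0"
  shows "\<exists>G\<in>\<G>. \<forall>H\<in>\<G>. (\<integral>\<^sup>+ x. ennreal (H x * dual_weight r G x) \<partial>M) \<le> ennreal (4 * (1 + S0))"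
proof -
  define v where "v G = enn2real (cell_norm r G)" for G
  have fin: "cell_norm r G < top" if "G \<in> \<G>" for G
    using bound[OF that] by (rule le_less_trans) simp
  have v: "cell_norm r G = ennreal (v G)" "0 \<le> v G" "v G \<le> S0" if "G \<in> \<G>" for G
    using fin[OF that] bound[OF that] S0 by (auto simp: v_def enn2real_leI)
  have bdd: "bdd_above (v ` \<G>)" using v(3) by (intro bdd_aboveI2)
  \<comment> \<open>\<open>s\<close> is both the step length towards \<open>H\<close> and the
    tolerance of the almost maximizer. It is so small that a step changes \<open>G\<close> by a
    factor between 1/2 and 2.\<close>
  define s where "s = 1 / L"
  have s: "0 < s" "s \<le> 1 / 2" "s * L = 1" using L by (auto simp: s_def field_simps)
  obtain G where G: "G \<in> \<G>" "(SUP G\<in>\<G>. v G) - s < v G"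
    using less_cSUP_iff[OF ne bdd, of "(SUP G\<in>\<G>. v G) - s"] s by auto
  have "(\<integral>\<^sup>+ x. ennreal (H x * dual_weight r G x) \<partial>M) \<le> ennreal (4 * (1 + S0))" if H: "H \<in> \<G>" for H
  proof -
    \<comment> \<open>The tangent is taken at \<open>K\<close> rather than at \<open>G\<close>.
      Euler's identity gives \<open>v K\<close> as the combination of \<open>g\<close> and
      \<open>h\<close>, the tangent inequality gives \<open>v G \<le> g\<close>, and almost
      maximality gives \<open>v K \<le> v G + s\<close>. Subtracting and dividing by
      \<open>s\<close> bounds \<open>h\<close> by \<open>1 + v G\<close>.\<close>
    define K where "K = (\<lambda>x. (1 - s) * G x + s * H x)"
    have K: "K \<in> \<G>" unfolding K_def using G H s by (intro conv) auto
    note [measurable] = meas[OF G(1)] meas[OF H] meas[OF K]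
    let ?w = "dual_weight r K"
    have w: "0 < ?w x" for x
      by (rule dual_weight_pos[OF r _ pos[OF K] fin[OF K]]) measurable
    have vK: "v K \<le> v G + s"
      using cSUP_upper[OF K bdd] G(2) by linarith
    define h where "h = (\<integral>\<^sup>+ x. ennreal (H x * ?w x) \<partial>M)"
    define g where "g = (\<integral>\<^sup>+ x. ennreal (G x * ?w x) \<partial>M)"
    have "ennreal (v K) = (\<integral>\<^sup>+ x. ennreal (K x * ?w x) \<partial>M)"
      unfolding v(1)[OF K, symmetric]
      by (rule cell_norm_eq_dual_weight[OF r _ pos[OF K] fin[OF K]]) measurable
    also have "\<dots> = (\<integral>\<^sup>+ x. ennreal (1 - s) * ennreal (G x * ?w x) + ennreal s * ennreal (H x * ?w x) \<partial>M)"
    proof (rule nn_integral_cong)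
      fix x
      have "0 \<le> G x * ?w x" "0 \<le> H x * ?w x"
        using w[of x] pos[OF G(1), of x] pos[OF H, of x] by auto
      moreover have "K x * W = (1 - s) * (G x * W) + s * (H x * W)" for W
        by (simp add: K_def algebra_simps)
      ultimately show "ennreal (K x * ?w x) = ennreal (1 - s) * ennreal (G x * ?w x) + ennreal s * ennreal (H x * ?w x)"
        using s by (simp flip: ennreal_mult ennreal_plus)
    qed
    also have "\<dots> = ennreal (1 - s) * g + ennreal s * h"
      by (simp add: nn_integral_add nn_integral_cmult g_def h_def)
    finally have eq: "ennreal (v K) = ennreal (1 - s) * g + ennreal s * h" .
    have "g \<noteq> top"
      using eq s by (auto simp: ennreal_mult_top)
    then obtain g' where g': "g = ennreal g'" "0 \<le> g'" by (cases g) auto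
    have "h \<noteq> top"
      using eq s by (auto simp: ennreal_mult_top)
    then obtain h' where h': "h = ennreal h'" "0 \<le> h'" by (cases h) auto
    have eq': "v K = (1 - s) * g' + s * h'"
      using eq v(2)[OF K] s g' h' by (simp flip: ennreal_mult ennreal_plus)
    have "ennreal (v G) \<le> g"
      unfolding v(1)[OF G(1), symmetric] g_def
      by (rule cell_norm_le_dual_weight[OF r _ pos[OF K] fin[OF K] _ pos[OF G(1)]]) measurable
    then have "v G \<le> g'" using g' by simp
    then have "(1 - s) * v G \<le> (1 - s) * g'" using s by (intro mult_left_mono) auto
    then have "s * h' \<le> s * (1 + v G)"
      using eq' vK by (simp add: algebra_simps)
    then have "h' \<le> 1 + v G" using s by (subst (asm) mult_le_cancel_left_pos) auto
    then have h: "h \<le> ennreal (1 + S0)"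
      using v(3)[OF G(1)] h' by (simp add: ennreal_leI)
    \<comment> \<open>Replaces the weight of \<open>K\<close>, which depends on \<open>H\<close>, by
      that of \<open>G\<close>, which does not. The 4 is the product of two factors 2, one from
      \<open>G \<le> 2 * K\<close> in the quasinorm and one from \<open>K \<le> 2 * G\<close> in the
      denominator.\<close>
    have "dual_weight r G x \<le> 4 * ?w x" for x
    proof -
      let ?m = "cell_quasinorm r G (k x)" and ?n = "cell_quasinorm r K (k x)"
      have Gx: "G x > 0" "K x > 0" using pos G K by auto
      have n: "?m > 0" "?n > 0"
        using cell_int_powr_eq(1)[OF r _ pos[OF G(1)] fin[OF G(1)]]
          cell_int_powr_eq(1)[OF r _ pos[OF K] fin[OF K]] by auto
      have half: "1 / 2 * G y \<le> K y" for y
      proof -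
        have "1 / 2 * G y \<le> (1 - s) * G y" using s pos[OF G(1), of y] by (intro mult_right_mono) auto
        also have "\<dots> \<le> K y" using s pos[OF H, of y] by (simp add: K_def)
        finally show ?thesis .
      qed
      have mn: "1 / 2 * ?m \<le> ?n"
        by (rule cell_quasinorm_scale_le[OF r _ _ _ pos[OF G(1)] fin[OF G(1)] fin[OF K] half]) auto
      have "s * H x \<le> s * (L * G x)" using comp[OF G(1) H] s by (intro mult_left_mono) auto
      also have "s * (L * G x) = G x" using s(3) by (simp flip: mult.assoc)
      finally have "s * H x \<le> G x" .
      moreover have "(1 - s) * G x \<le> 1 * G x" using s Gx by (intro mult_right_mono) auto
      ultimately have "K x \<le> 2 * G x" by (simp add: K_def)
      then have "?m * K x \<le> (2 * ?n) * (2 * G x)"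
        using mn n Gx by (intro mult_mono) auto
      then have "?m / G x \<le> 4 * ?n / K x"
        using Gx by (subst pos_divide_le_eq) (simp_all add: pos_le_divide_eq)
      then have "?m / G x \<le> 4 * (?n / K x)" by simp
      then have "dual_weight r G x \<le> (4 * (?n / K x)) powr (1 - r)"
        unfolding dual_weight_def using r n Gx by (intro powr_mono2) auto
      also have "\<dots> = 4 powr (1 - r) * ?w x"
        using n Gx by (subst powr_mult) (auto simp: dual_weight_def)
      also have "\<dots> \<le> 4 powr 1 * ?w x"
        using r w[of x] by (intro mult_right_mono powr_mono) auto
      finally show ?thesis by simp
    qed
    then have "(\<integral>\<^sup>+ x. ennreal (H x * dual_weight r G x) \<partial>M) \<le> (\<integral>\<^sup>+ x. ennreal 4 * ennreal (H x * ?w x) \<partial>M)"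
    proof (intro nn_integral_mono)
      fix x assume *: "\<And>x. dual_weight r G x \<le> 4 * ?w x"
      have "H x * dual_weight r G x \<le> H x * (4 * ?w x)"
        using * pos[OF H, of x] by (intro mult_left_mono) auto
      then have "ennreal (H x * dual_weight r G x) \<le> ennreal (4 * (H x * ?w x))"
        by (intro ennreal_leI) (simp add: mult_ac)
      also have "\<dots> = ennreal 4 * ennreal (H x * ?w x)"
        using pos[OF H, of x] w[of x] by (intro ennreal_mult) auto
      finally show "ennreal (H x * dual_weight r G x) \<le> ennreal 4 * ennreal (H x * ?w x)" .
    qed
    also have "\<dots> = ennreal 4 * h"
      by (simp add: nn_integral_cmult h_def)
    also have "\<dots> \<le> ennreal 4 * ennreal (1 + S0)"
      by (intro mult_left_mono h) auto
    also have "\<dots> = ennreal (4 * (1 + S0))"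
      using S0 by (intro ennreal_mult[symmetric]) auto
    finally show ?thesis .
  qed
  with G(1) show ?thesis by blast
qed

text \<open>Take \<open>g\<close> to be the weight to the power -1/2, so that division by
  \<open>(g x)\<^sup>2\<close> is multiplication by the weight. Then \<open>g\<close> to the power
  \<open>2 * r / (1 - r)\<close> equals \<open>(G / n) powr r\<close>, with \<open>n\<close> the
  quasinorm of the cell, and has integral one over each cell.\<close>

lemma exists_multiplier_convex:
  fixes \<G> :: "('b \<Rightarrow> real) set"
  assumes r: "0 < r" "r < 1" and L: "2 \<le> L" and S0: "0 \<le> S0" and ne: "\<G> \<noteq> {}"
    and conv: "\<And>G H s. G \<in> \<G> \<Longrightarrow> H \<in> \<G> \<Longrightarrow> 0 \<le> s \<Longrightarrow> s \<le> 1 \<Longrightarrow> (\<lambda>x. (1 - s) * G x + s * H x) \<in> \<G>"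
    and comp: "\<And>G H x. G \<in> \<G> \<Longrightarrow> H \<in> \<G> \<Longrightarrow> H x \<le> L * G x"
    and meas: "\<And>G. G \<in> \<G> \<Longrightarrow> G \<in> borel_measurable M"
    and pos: "\<And>G x. G \<in> \<G> \<Longrightarrow> 0 < G x"
    and bound: "\<And>G. G \<in> \<G> \<Longrightarrow> cell_norm r G \<le> ennreal S0"
  shows "\<exists>g. g \<in> borel_measurable M \<and> (\<forall>x. 0 < g x) \<and>
    (\<forall>a. cell_int (\<lambda>x. ennreal (g x powr (2 * r / (1 - r)))) a \<le> 1) \<and>
    (\<forall>H\<in>\<G>. (\<integral>\<^sup>+ x. ennreal (H x / (g x)\<^sup>2) \<partial>M) \<le> ennreal (4 * (1 + S0)))"
proof -
  obtain G where G: "G \<in> \<G>"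
    and w: "\<And>H. H \<in> \<G> \<Longrightarrow> (\<integral>\<^sup>+ x. ennreal (H x * dual_weight r G x) \<partial>M) \<le> ennreal (4 * (1 + S0))"
  proof -
    have "\<exists>G\<in>\<G>. \<forall>H\<in>\<G>. (\<integral>\<^sup>+ x. ennreal (H x * dual_weight r G x) \<partial>M) \<le> ennreal (4 * (1 + S0))"
      by (rule almost_maximizer_weight[OF r L S0 ne]) (rule conv comp meas pos bound; assumption)+
    then show ?thesis using that by auto
  qed
  note [measurable] = meas[OF G]
  have fin: "cell_norm r G < top"
    using bound[OF G] by (rule le_less_trans) simp
  note wpos = dual_weight_pos[OF r meas[OF G] pos[OF G] fin]
  define g where "g x = dual_weight r G x powr (- 1 / 2)" for x
  have g2: "H / (g x)\<^sup>2 = H * dual_weight r G x" for H x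
  proof -
    have "(g x)\<^sup>2 = dual_weight r G x powr (- 1)"
      using wpos[of x] by (simp add: g_def powr_powr flip: powr_numeral)
    then have "(g x)\<^sup>2 = 1 / dual_weight r G x"
      using wpos[of x] by (simp add: powr_minus inverse_eq_divide)
    then show ?thesis by simp
  qed
  have gq: "cell_int (\<lambda>x. ennreal (g x powr (2 * r / (1 - r)))) a = 1" for a
  proof -
    let ?n = "cell_quasinorm r G a"
    have n: "?n > 0" by (rule cell_int_powr_eq[OF r meas[OF G] pos[OF G] fin])
    have "cell_int (\<lambda>x. ennreal (g x powr (2 * r / (1 - r)))) a =
       cell_int (\<lambda>x. ennreal (1 / ?n powr r) * ennreal (G x powr r)) a"
    proof (rule cell_int_cong)
      fix x assume "k x = a"
      then have "g x powr (2 * r / (1 - r)) = (?n / G x) powr ((1 - r) * (- 1 / 2) * (2 * r / (1 - r)))"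
        unfolding g_def dual_weight_def powr_powr by simp
      also have "(1 - r) * (- 1 / 2) * (2 * r / (1 - r)) = - r"
        using r by (simp add: field_simps)
      also have "(?n / G x) powr - r = 1 / ?n powr r * G x powr r"
        using n pos[OF G, of x] by (simp add: powr_minus powr_divide)
      finally show "ennreal (g x powr (2 * r / (1 - r))) = ennreal (1 / ?n powr r) * ennreal (G x powr r)"
        by (simp flip: ennreal_mult)
    qed
    also have "\<dots> = ennreal (1 / ?n powr r) * ennreal (?n powr r)"
      by (subst cell_int_cmult, measurable)
         (simp only: cell_int_powr_eq(2)[OF r meas[OF G] pos[OF G] fin])
    also have "\<dots> = 1"
      using n by (simp flip: ennreal_mult)
    finally show ?thesis .
  qed
  show ?thesis
  proof (intro exI[of _ g] conjI allI ballI)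
    show "g \<in> borel_measurable M" unfolding g_def by measurable
    show "0 < g x" for x using wpos[of x] by (simp add: g_def)
  qed (use gq w g2 in auto)
qed

end

subsection \<open>Simultaneous multipliers for finitely many vectors\<close>

lemma AE_summable_of_square_bound:
  fixes d :: "nat \<Rightarrow> 'b \<Rightarrow> real"
  assumes "finite_measure M" and [measurable]: "\<And>n. d n \<in> borel_measurable M"
    and le: "\<And>n. (\<integral>\<^sup>+ x. ennreal ((d n x)\<^sup>2) \<partial>M) \<le> ennreal (8 * (1 / 8) ^ n)"
  shows "AE x in M. summable (\<lambda>n. \<bar>d n x\<bar>)"
proof -
  interpret finite_measure M by fact
  let ?\<mu> = "measure M (space M)"
  have le1: "(\<integral>\<^sup>+ x. ennreal \<bar>d n x\<bar> \<partial>M) \<le> ennreal ((?\<mu> + 8) * (1 / 2) ^ n)" for n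
  proof -
    \<comment> \<open>Splitting at height \<open>(1 / 2) ^ n\<close> loses a factor
      \<open>2 ^ n\<close> on the squares. As these decay like \<open>(1 / 8) ^ n\<close>, a
      summable bound remains.\<close>
    have pw: "\<bar>t\<bar> \<le> (1 / 2) ^ n + 2 ^ n * t\<^sup>2" for t :: real
    proof (cases "\<bar>t\<bar> \<le> (1 / 2) ^ n")
      case False
      then have "1 \<le> 2 ^ n * \<bar>t\<bar>" by (simp add: field_simps)
      then have "1 * \<bar>t\<bar> \<le> 2 ^ n * \<bar>t\<bar> * \<bar>t\<bar>" by (intro mult_right_mono) auto
      then have "\<bar>t\<bar> \<le> 2 ^ n * t\<^sup>2" by (simp add: power2_eq_square mult.assoc)
      moreover have "(0::real) \<le> (1 / 2) ^ n" by simp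
      ultimately show ?thesis by linarith
    qed (simp add: add_increasing2)
    have "(\<integral>\<^sup>+ x. ennreal \<bar>d n x\<bar> \<partial>M) \<le> (\<integral>\<^sup>+ x. ennreal ((1 / 2) ^ n) + ennreal (2 ^ n) * ennreal ((d n x)\<^sup>2) \<partial>M)"
      using pw by (intro nn_integral_mono) (simp add: ennreal_leI flip: ennreal_mult ennreal_plus)
    also have "\<dots> = ennreal ((1 / 2) ^ n) * emeasure M (space M) + ennreal (2 ^ n) * (\<integral>\<^sup>+ x. ennreal ((d n x)\<^sup>2) \<partial>M)"
      by (simp add: nn_integral_add nn_integral_cmult)
    also have "\<dots> \<le> ennreal ((1 / 2) ^ n) * emeasure M (space M) + ennreal (2 ^ n) * ennreal (8 * (1 / 8) ^ n)"
      by (intro add_left_mono mult_left_mono le) auto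
    also have "\<dots> = ennreal ((1 / 2) ^ n * ?\<mu> + 2 ^ n * (8 * (1 / 8) ^ n))"
      by (simp add: emeasure_eq_measure flip: ennreal_mult ennreal_plus)
    also have "(1 / 2) ^ n * ?\<mu> + 2 ^ n * (8 * (1 / 8) ^ n) \<le> (?\<mu> + 8) * (1 / 2) ^ n"
    proof -
      have "2 ^ n * (1 / 8) ^ n = (1 / 4 :: real) ^ n" by (simp flip: power_mult_distrib)
      also have "\<dots> \<le> (1 / 2) ^ n" by (intro power_mono) auto
      finally show ?thesis by (simp add: algebra_simps)
    qed
    finally show ?thesis by (simp add: ennreal_leI)
  qed
  have sums: "(\<lambda>n. (?\<mu> + 8) * (1 / 2) ^ n) sums ((?\<mu> + 8) * 2)"
    using geometric_sums[of "1 / 2 :: real"] by (intro sums_mult) simp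
  have "(\<integral>\<^sup>+ x. (\<Sum>n. ennreal \<bar>d n x\<bar>) \<partial>M) = (\<Sum>n. \<integral>\<^sup>+ x. ennreal \<bar>d n x\<bar> \<partial>M)"
    by (rule nn_integral_suminf) measurable
  also have "\<dots> \<le> (\<Sum>n. ennreal ((?\<mu> + 8) * (1 / 2) ^ n))"
    by (intro suminf_le le1) auto
  also have "\<dots> = ennreal ((?\<mu> + 8) * 2)"
    using sums by (subst suminf_ennreal2) (auto simp: sums_iff)
  finally have "(\<integral>\<^sup>+ x. (\<Sum>n. ennreal \<bar>d n x\<bar>) \<partial>M) \<noteq> \<infinity>"
    by (auto simp: top_unique)
  then have "AE x in M. (\<Sum>n. ennreal \<bar>d n x\<bar>) \<noteq> \<infinity>"
    by (intro nn_integral_noteq_infinite) auto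
  then show ?thesis
    by eventually_elim (auto intro!: summable_suminf_not_top)
qed

text \<open>A directed family of convex bounded sets in \<open>L\<^sup>2\<close> has a common limit point: by the
  parallelogram law, almost minimal elements form a Cauchy net.\<close>

lemma directed_midpoint_convex_limit:
  fixes P :: "'i set \<Rightarrow> ('b \<Rightarrow> real) set"
  assumes "finite_measure M"
    and anti: "\<And>A A'. finite A' \<Longrightarrow> A' \<subseteq> I \<Longrightarrow> A \<subseteq> A' \<Longrightarrow> P A' \<subseteq> P A"
    and ne: "\<And>A. finite A \<Longrightarrow> A \<subseteq> I \<Longrightarrow> P A \<noteq> {}"
    and mid: "\<And>A g h. finite A \<Longrightarrow> A \<subseteq> I \<Longrightarrow> g \<in> P A \<Longrightarrow> h \<in> P A \<Longrightarrow> (\<lambda>x. (g x + h x) / 2) \<in> P A"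
    and meas: "\<And>A g. finite A \<Longrightarrow> A \<subseteq> I \<Longrightarrow> g \<in> P A \<Longrightarrow> g \<in> borel_measurable M"
    and bound: "\<And>A g. finite A \<Longrightarrow> A \<subseteq> I \<Longrightarrow> g \<in> P A \<Longrightarrow> (\<integral>\<^sup>+ x. ennreal ((g x)\<^sup>2) \<partial>M) \<le> ennreal K"
  shows "\<exists>g\<in>borel_measurable M. \<forall>i\<in>I. \<exists>h. (\<forall>n. h n \<in> P {i}) \<and> (AE x in M. (\<lambda>n. h n x) \<longlonglongrightarrow> g x)"
proof -
  define \<F> where "\<F> = {A. finite A \<and> A \<subseteq> I}"
  define e where "e g = (\<integral>x. (g x)\<^sup>2 \<partial>M)" for g :: "'b \<Rightarrow> real"
  \<comment> \<open>Squared distance of \<open>P A\<close> from the origin. It grows with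
    \<open>A\<close> and stays below \<open>\<bar>K\<bar>\<close>, so it has a finite supremum
    \<open>m'\<close> over the directed family.\<close>
  define m where "m A = (INF g\<in>P A. e g)" for A
  have int: "integrable M (\<lambda>x. (g x)\<^sup>2)" if "A \<in> \<F>" "g \<in> P A" for g A
  proof (rule integrableI_bounded)
    show "(\<lambda>x. (g x)\<^sup>2) \<in> borel_measurable M"
      using meas that by (auto simp: \<F>_def)
    show "(\<integral>\<^sup>+ x. ennreal (norm ((g x)\<^sup>2)) \<partial>M) < \<infinity>"
      using bound[of A g] that by (auto simp: \<F>_def intro: le_less_trans)
  qed
  have e0: "0 \<le> e g" for g by (simp add: e_def)
  have eK: "e g \<le> \<bar>K\<bar>" if "A \<in> \<F>" "g \<in> P A" for g A
  proof -
    have "ennreal (e g) = (\<integral>\<^sup>+ x. ennreal ((g x)\<^sup>2) \<partial>M)"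
      unfolding e_def by (rule nn_integral_eq_integral[symmetric]) (use int that in auto)
    also have "\<dots> \<le> ennreal \<bar>K\<bar>"
      using bound[of A g] that by (auto simp: \<F>_def intro: order.trans[OF _ ennreal_leI])
    finally show ?thesis by simp
  qed
  have bdd: "bdd_below (e ` P A)" for A by (rule bdd_belowI2) (rule e0)
  have m_le: "m A \<le> e g" if "g \<in> P A" for A g
    unfolding m_def by (rule cINF_lower[OF bdd that])
  have m_mono: "m A \<le> m A'" if "A' \<in> \<F>" "A \<subseteq> A'" for A A'
    unfolding m_def using that anti ne bdd by (intro cINF_superset_mono) (auto simp: \<F>_def)
  have mK: "m A \<le> \<bar>K\<bar>" if A: "A \<in> \<F>" for A
  proof -
    obtain g where "g \<in> P A" using ne A by (auto simp: \<F>_def)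
    with m_le[OF this] eK[OF A this] show ?thesis by simp
  qed
  have bdd_m: "bdd_above (m ` \<F>)" by (rule bdd_aboveI2) (rule mK)
  have ne_\<F>: "\<F> \<noteq> {}" by (auto simp: \<F>_def)
  define m' where "m' = (SUP A\<in>\<F>. m A)"
  have m_le_m': "m A \<le> m'" if "A \<in> \<F>" for A
    unfolding m'_def by (rule cSUP_upper[OF that bdd_m])
  define \<epsilon> :: "nat \<Rightarrow> real" where "\<epsilon> n = (1 / 8) ^ n" for n
  have \<epsilon>: "\<epsilon> n > 0" for n by (simp add: \<epsilon>_def)
  have \<epsilon>_Suc: "\<epsilon> (Suc n) \<le> \<epsilon> n" for n by (simp add: \<epsilon>_def)
  have "\<exists>A\<in>\<F>. m' - \<epsilon> n < m A" for n
    using less_cSUP_iff[OF ne_\<F> bdd_m, of "m' - \<epsilon> n"] \<epsilon>[of n] by (simp add: m'_def)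
  then obtain A0 where A0: "\<And>n. A0 n \<in> \<F>" "\<And>n. m' - \<epsilon> n < m (A0 n)" by metis
  \<comment> \<open>The unions form an increasing sequence, and enlarging a set keeps
    \<open>m\<close> above \<open>m' - \<epsilon> n\<close>.\<close>
  define A where "A n = (\<Union>k\<le>n. A0 k)" for n
  have A: "A n \<in> \<F>" for n using A0 by (auto simp: A_def \<F>_def)
  have A_mono: "A n \<subseteq> A (Suc n)" for n unfolding A_def by (intro UN_mono) auto
  have mA: "m' - \<epsilon> n < m (A n)" for n
    using m_mono[OF A[of n], of "A0 n"] A0(2)[of n] by (force simp: A_def)
  have near: "\<exists>g\<in>P A. e g \<le> m' + \<epsilon> n" if A: "A \<in> \<F>" for A n
  proof -
    have "m A < m' + \<epsilon> n" using m_le_m'[OF A] \<epsilon>[of n] by simp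
    then show ?thesis
      using cINF_less_iff[OF ne bdd, of A] A unfolding m_def by (force simp: \<F>_def)
  qed
  \<comment> \<open>Parallelogram law: the midpoint lies in \<open>P (A n)\<close>, so its energy is
    at least \<open>m (A n)\<close>, hence more than \<open>m' - \<epsilon> n\<close>. Four times
    the gap of \<open>2 * \<epsilon> n\<close> between the upper and lower bounds gives
    \<open>8 * \<epsilon> n\<close>.\<close>
  have close: "(\<integral>\<^sup>+ x. ennreal ((g x - h x)\<^sup>2) \<partial>M) \<le> ennreal (8 * (1 / 8) ^ n)"
    if gh: "g \<in> P (A n)" "h \<in> P (A n)" "e g \<le> m' + \<epsilon> n" "e h \<le> m' + \<epsilon> n" for g h n
  proof -
    let ?u = "\<lambda>x. (g x + h x) / 2"
    have u: "?u \<in> P (A n)" using mid A gh by (auto simp: \<F>_def)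
    have eq: "(g x - h x)\<^sup>2 = 2 * (g x)\<^sup>2 + 2 * (h x)\<^sup>2 - 4 * (?u x)\<^sup>2" for x
      by (simp add: power2_eq_square field_simps)
    note ints = int[OF A gh(1)] int[OF A gh(2)] int[OF A u]
    have i: "integrable M (\<lambda>x. (g x - h x)\<^sup>2)"
      unfolding eq by (intro Bochner_Integration.integrable_add Bochner_Integration.integrable_diff integrable_mult_right ints)
    have "(\<integral>x. (g x - h x)\<^sup>2 \<partial>M) = 2 * e g + 2 * e h - 4 * e ?u"
      unfolding eq e_def using ints by simp
    also have "\<dots> \<le> 8 * \<epsilon> n"
      using m_le[OF u] mA[of n] gh by linarith
    finally show ?thesis
      using i by (subst nn_integral_eq_integral) (auto simp: \<epsilon>_def intro!: ennreal_leI)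
  qed
  obtain g where g: "\<And>n. g n \<in> P (A n)" "\<And>n. e (g n) \<le> m' + \<epsilon> n"
  proof -
    have "\<forall>n. \<exists>g. g \<in> P (A n) \<and> e g \<le> m' + \<epsilon> n" using near[OF A] by blast
    then show ?thesis using that by metis
  qed
  have g_meas [measurable]: "g n \<in> borel_measurable M" for n
    using meas[of "A n" "g n"] g(1)[of n] A[of n] by (auto simp: \<F>_def)
  have "AE x in M. summable (\<lambda>n. \<bar>g (Suc n) x - g n x\<bar>)"
  proof (rule AE_summable_of_square_bound[OF assms(1)])
    show "(\<integral>\<^sup>+ x. ennreal ((g (Suc n) x - g n x)\<^sup>2) \<partial>M) \<le> ennreal (8 * (1 / 8) ^ n)" for n
    proof (rule close)
      show "g (Suc n) \<in> P (A n)"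
        using anti[of "A (Suc n)" "A n"] A[of "Suc n"] A_mono g(1) by (auto simp: \<F>_def)
      show "e (g (Suc n)) \<le> m' + \<epsilon> n" using g(2)[of "Suc n"] \<epsilon>_Suc[of n] by linarith
    qed (use g in auto)
  qed measurable
  then have conv: "AE x in M. (\<lambda>n. g n x) \<longlonglongrightarrow> lim (\<lambda>n. g n x)"
  proof eventually_elim
    case (elim x)
    then have "summable (\<lambda>n. g (Suc n) x - g n x)"
      by (intro summable_norm_cancel[of "\<lambda>n. g (Suc n) x - g n x"]) simp
    then have "convergent (\<lambda>n. \<Sum>i<n. g (Suc i) x - g i x)"
      by (simp add: summable_iff_convergent)
    then have "convergent (\<lambda>n. g n x - g 0 x)"
      by (simp only: sum_lessThan_telescope[of "\<lambda>n. g n x"])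
    then have "convergent (\<lambda>n. g n x)"
      by (simp add: convergent_diff_const_right_iff)
    then show ?case by (simp add: convergent_LIMSEQ_iff)
  qed
  show ?thesis
  proof (intro bexI[of _ "\<lambda>x. lim (\<lambda>n. g n x)"] ballI)
    fix i assume i: "i \<in> I"
    \<comment> \<open>The index set may be uncountable, so \<open>i\<close> need not lie in any
      \<open>A n\<close>. An almost minimizer over \<open>insert i (A n)\<close> belongs to
      \<open>P {i}\<close> and is close to \<open>g n\<close>, hence converges to the same
      limit.\<close>
    have Ai: "insert i (A n) \<in> \<F>" for n using A[of n] i by (auto simp: \<F>_def)
    obtain h where h: "\<And>n. h n \<in> P (insert i (A n))" "\<And>n. e (h n) \<le> m' + \<epsilon> n"
    proof -
      have "\<forall>n. \<exists>h. h \<in> P (insert i (A n)) \<and> e h \<le> m' + \<epsilon> n" using near[OF Ai] by blast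
      then show ?thesis using that by metis
    qed
    have hi: "h n \<in> P {i}" for n
      using anti[of "insert i (A n)" "{i}"] Ai[of n] h(1) by (auto simp: \<F>_def)
    have hA: "h n \<in> P (A n)" for n
      using anti[of "insert i (A n)" "A n"] Ai[of n] h(1) by (auto simp: \<F>_def)
    have [measurable]: "h n \<in> borel_measurable M" for n
      using meas[of "A n" "h n"] hA[of n] A[of n] by (auto simp: \<F>_def)
    have "AE x in M. summable (\<lambda>n. \<bar>h n x - g n x\<bar>)"
      by (rule AE_summable_of_square_bound[OF assms(1) _ close]) (use g h hA in auto)
    with conv have "AE x in M. (\<lambda>n. h n x) \<longlonglongrightarrow> lim (\<lambda>n. g n x)"
    proof eventually_elim
      case (elim x)
      have "(\<lambda>n. h n x - g n x) \<longlonglongrightarrow> 0"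
        using summable_LIMSEQ_zero[OF elim(2)] by (simp add: tendsto_rabs_zero_iff)
      from tendsto_add[OF this elim(1)] show ?case by simp
    qed
    with hi show "\<exists>h. (\<forall>n. h n \<in> P {i}) \<and> (AE x in M. (\<lambda>n. h n x) \<longlonglongrightarrow> lim (\<lambda>n. g n x))"
      by auto
  qed (rule borel_measurable_lim_metric, measurable)
qed

context cells
begin

text \<open>The bound does not depend on the finite set \<open>A\<close>, which is what a limit over
  all such sets requires. The summand \<open>\<phi>\<close> makes all convex combinations strictly
  positive.\<close>

lemma exists_multiplier_finite:
  fixes X :: "'h::real_normed_vector \<Rightarrow> 'b \<Rightarrow> complex"
  assumes r: "0 < r" "r < 1"
    and parallelogram:
      "\<And>u v :: 'h. (norm (u + v))\<^sup>2 + (norm (u - v))\<^sup>2 = 2 * (norm u)\<^sup>2 + 2 * (norm v)\<^sup>2"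
    and meas [measurable]: "\<And>u. X u \<in> borel_measurable M"
    and add: "\<And>u v. AE x in M. X (u + v) x = X u x + X v x"
    and scale: "\<And>c u. AE x in M. X (c *\<^sub>R u) x = c *\<^sub>R X u x"
    and B: "0 \<le> B" "\<And>u. cell_norm r (\<lambda>x. (norm (X u x))\<^sup>2) \<le> ennreal (B * (norm u)\<^sup>2)"
    and \<phi>: "\<phi> \<in> borel_measurable M" "\<And>x. 0 < \<phi> x" "cell_norm r \<phi> \<le> ennreal c" "0 \<le> c"
    and A: "finite A" "A \<noteq> {}" "\<And>f. f \<in> A \<Longrightarrow> norm f \<le> 1"
  shows "\<exists>g. g \<in> borel_measurable M \<and> (\<forall>x. 0 < g x) \<and>
    (\<forall>a. cell_int (\<lambda>x. ennreal (g x powr (2 * r / (1 - r)))) a \<le> 1) \<and>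
    (\<forall>f\<in>A. (\<integral>\<^sup>+ x. ennreal (((norm (X f x))\<^sup>2 + \<phi> x) / (g x)\<^sup>2) \<partial>M) \<le>
      ennreal (8 * (1 + 2 powr (1 / r) * (12 powr (1 / r) * B + c))))"
proof -
  note [measurable] = \<phi>(1)
  define n where "n = real (card A)"
  have n: "n \<ge> 1" using A by (simp add: n_def Suc_leI card_gt_0_iff)
  define S0 where "S0 = 2 powr (1 / r) * (12 powr (1 / r) * B + c)"
  define F where "F f x = (norm (X f x))\<^sup>2" for f x
  have F0: "0 \<le> F f x" for f x by (simp add: F_def)
  have [measurable]: "F f \<in> borel_measurable M" for f unfolding F_def by measurable
  define C where "C t x = (\<Sum>f\<in>A. t f * F f x) + \<phi> x" for t x
  \<comment> \<open>Coefficients bounded away from \<open>0\<close> make the functions \<open>C t\<close> comparable to each other.\<close>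
  define D where "D = {t. (\<forall>f\<in>A. 1 / (2 * n) \<le> t f) \<and> sum t A = 1}"
  have D: "1 / (2 * n) \<le> t f" "0 \<le> t f" "t f \<le> 1" if "t \<in> D" "f \<in> A" for t f
  proof -
    have *: "0 \<le> t f'" if "f' \<in> A" for f'
      using \<open>t \<in> D\<close> that n by (auto simp: D_def intro: order.trans[rotated])
    show "1 / (2 * n) \<le> t f" "0 \<le> t f" using that * by (auto simp: D_def)
    have "t f \<le> sum t A" using A that * by (intro member_le_sum) auto
    then show "t f \<le> 1" using that by (simp add: D_def)
  qed
  have C_meas [measurable]: "C t \<in> borel_measurable M" for t
    unfolding C_def by measurable
  have sum0: "0 \<le> (\<Sum>f\<in>A. t f * F f x)" if "t \<in> D" for t x
    using D[OF that] F0 by (intro sum_nonneg) auto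
  have pos: "0 < C t x" if "t \<in> D" for t x
    using sum0[OF that, of x] \<phi>(2)[of x] by (simp add: C_def)
  \<comment> \<open>Coefficients lie between \<open>1 / (2 * n)\<close> and \<open>1\<close>, so
    their ratios are at most \<open>2 * n\<close>; this is the constant \<open>L\<close> of
    \<open>exists_multiplier_convex\<close>.\<close>
  have comp: "C t x \<le> 2 * n * C t' x" if "t \<in> D" "t' \<in> D" for t t' x
  proof -
    have "(\<Sum>f\<in>A. t f * F f x) \<le> (\<Sum>f\<in>A. 2 * n * (t' f * F f x))"
    proof (rule sum_mono)
      fix f assume f: "f \<in> A"
      have "t f \<le> 1" by (rule D[OF that(1) f])
      also have "1 = 2 * n * (1 / (2 * n))" using n by simp
      also have "\<dots> \<le> 2 * n * t' f" using D(1)[OF that(2) f] n by (intro mult_left_mono) auto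
      finally show "t f * F f x \<le> 2 * n * (t' f * F f x)"
        using F0[of f x] by (simp add: mult_right_mono flip: mult.assoc)
    qed
    moreover have "1 * \<phi> x \<le> 2 * n * \<phi> x" using n \<phi>(2)[of x] by (intro mult_right_mono) auto
    ultimately show ?thesis by (simp add: C_def sum_distrib_left distrib_left)
  qed
  have conv: "(\<lambda>x. (1 - s) * C t x + s * C t' x) \<in> C ` D"
    if "t \<in> D" "t' \<in> D" "0 \<le> s" "s \<le> 1" for s t t'
  proof (rule image_eqI)
    show "(\<lambda>x. (1 - s) * C t x + s * C t' x) = C (\<lambda>f. (1 - s) * t f + s * t' f)"
      by (rule ext) (simp add: C_def sum_distrib_left sum.distrib algebra_simps sum_subtractf)
    show "(\<lambda>f. (1 - s) * t f + s * t' f) \<in> D"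
    proof -
      have "1 / (2 * n) \<le> (1 - s) * t f + s * t' f" if "f \<in> A" for f
      proof -
        have "(1 - s) * (1 / (2 * n)) + s * (1 / (2 * n)) \<le> (1 - s) * t f + s * t' f"
          using D(1) that \<open>t \<in> D\<close> \<open>t' \<in> D\<close> \<open>0 \<le> s\<close> \<open>s \<le> 1\<close> by (intro add_mono mult_left_mono) auto
        then show ?thesis by (simp only: distrib_right[symmetric]) simp
      qed
      then show ?thesis
        using that by (simp add: D_def sum.distrib flip: sum_distrib_left)
    qed
  qed
  have bound: "cell_norm r (C t) \<le> ennreal S0" if t: "t \<in> D" for t
  proof -
    \<comment> \<open>The coefficients are moved into the vectors as square roots. The rescaled
      vectors have squared norms of total at most \<open>sum t A = 1\<close>, which makes the bound
      uniform in \<open>A\<close>.\<close>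
    have "AE x in M. \<forall>f\<in>A. X (sqrt (t f) *\<^sub>R f) x = sqrt (t f) *\<^sub>R X f x"
      using A by (intro AE_finite_allI scale) auto
    then have "AE x in M. 0 \<le> (\<Sum>f\<in>A. t f * F f x) \<and> (\<Sum>f\<in>A. t f * F f x) \<le> (\<Sum>f\<in>A. (norm (X (sqrt (t f) *\<^sub>R f) x))\<^sup>2)"
      by eventually_elim (use D[OF t] sum0[OF t] in \<open>auto simp: F_def power_mult_distrib\<close>)
    then have "cell_norm r (\<lambda>x. \<Sum>f\<in>A. t f * F f x) \<le> cell_norm r (\<lambda>x. \<Sum>f\<in>A. (norm (X (sqrt (t f) *\<^sub>R f) x))\<^sup>2)"
      by (intro cell_norm_mono_AE r)
    also have "\<dots> \<le> ennreal (12 powr (1 / r) * B * (\<Sum>f\<in>A. (norm (sqrt (t f) *\<^sub>R f))\<^sup>2))"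
      by (rule cell_norm_square_function_le[OF r parallelogram meas add scale B A(1)])
    also have "\<dots> \<le> ennreal (12 powr (1 / r) * B * 1)"
    proof (intro ennreal_leI mult_left_mono)
      have "(\<Sum>f\<in>A. (norm (sqrt (t f) *\<^sub>R f))\<^sup>2) \<le> (\<Sum>f\<in>A. t f * 1)"
        using D[OF t] A(3) by (intro sum_mono) (auto simp: power_mult_distrib intro!: mult_left_le power_le_one)
      then show "(\<Sum>f\<in>A. (norm (sqrt (t f) *\<^sub>R f))\<^sup>2) \<le> 1"
        using t by (simp add: D_def)
    qed (use B in auto)
    finally have *: "cell_norm r (\<lambda>x. \<Sum>f\<in>A. t f * F f x) \<le> ennreal (12 powr (1 / r) * B)" by simp
    have "cell_norm r (C t) \<le> ennreal (2 powr (1 / r)) * (cell_norm r (\<lambda>x. \<Sum>f\<in>A. t f * F f x) + cell_norm r \<phi>)"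
      unfolding C_def using sum0[OF t] \<phi>(2) by (intro cell_norm_add_le r) (auto intro: less_imp_le)
    also have "\<dots> \<le> ennreal (2 powr (1 / r)) * (ennreal (12 powr (1 / r) * B) + ennreal c)"
      by (intro mult_left_mono add_mono * \<phi>) auto
    also have "\<dots> = ennreal S0"
      using B(1) \<phi>(4) unfolding S0_def by (simp add: ennreal_mult)
    finally show ?thesis .
  qed
  have S0: "0 \<le> S0" using B(1) \<phi>(4) by (simp add: S0_def)
  have D_ne: "(\<lambda>_. 1 / n) \<in> D" using n A by (auto simp: D_def n_def field_simps)
  have "\<exists>g. g \<in> borel_measurable M \<and> (\<forall>x. 0 < g x) \<and>
    (\<forall>a. cell_int (\<lambda>x. ennreal (g x powr (2 * r / (1 - r)))) a \<le> 1) \<and>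
    (\<forall>H\<in>C ` D. (\<integral>\<^sup>+ x. ennreal (H x / (g x)\<^sup>2) \<partial>M) \<le> ennreal (4 * (1 + S0)))"
  proof (rule exists_multiplier_convex[OF r, where L = "2 * n"])
    show "(\<lambda>x. (1 - s) * G x + s * H x) \<in> C ` D"
      if "G \<in> C ` D" "H \<in> C ` D" "0 \<le> s" "s \<le> 1" for G H s
      using that conv by blast
  qed (use n S0 D_ne comp pos bound C_meas in auto)
  then obtain g where g: "g \<in> borel_measurable M" "\<And>x. 0 < g x"
      "\<And>a. cell_int (\<lambda>x. ennreal (g x powr (2 * r / (1 - r)))) a \<le> 1"
    and gC: "\<And>t. t \<in> D \<Longrightarrow> (\<integral>\<^sup>+ x. ennreal (C t x / (g x)\<^sup>2) \<partial>M) \<le> ennreal (4 * (1 + S0))"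
    by auto
  note [measurable] = g(1)
  have "(\<integral>\<^sup>+ x. ennreal ((F f x + \<phi> x) / (g x)\<^sup>2) \<partial>M) \<le> ennreal (8 * (1 + S0))" if f: "f \<in> A" for f
  proof -
    \<comment> \<open>Half of the mass is spread evenly to stay in \<open>D\<close> and half is put
      on \<open>f\<close>. Then \<open>2 * C t\<close> dominates \<open>F f + \<phi>\<close>, which
      turns the constant 4 into 8.\<close>
    define t where "t f' = 1 / (2 * n) + (if f' = f then 1 / 2 else 0)" for f'
    have t: "t \<in> D"
      using A f n by (auto simp: D_def t_def sum.distrib n_def)
    have "F f x + \<phi> x \<le> 2 * C t x" for x
    proof -
      have "1 / 2 * F f x \<le> t f * F f x"
        using n by (intro mult_right_mono F0) (auto simp: t_def)
      also have "\<dots> \<le> (\<Sum>f\<in>A. t f * F f x)"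
        using A f D[OF t] F0 by (intro member_le_sum) auto
      finally show ?thesis using \<phi>(2)[of x] by (simp add: C_def)
    qed
    then have "(\<integral>\<^sup>+ x. ennreal ((F f x + \<phi> x) / (g x)\<^sup>2) \<partial>M) \<le> (\<integral>\<^sup>+ x. ennreal (2 * (C t x / (g x)\<^sup>2)) \<partial>M)"
      by (intro nn_integral_mono ennreal_leI) (simp add: divide_right_mono)
    also have "\<dots> = (\<integral>\<^sup>+ x. ennreal 2 * ennreal (C t x / (g x)\<^sup>2) \<partial>M)"
      using pos[OF t] by (intro nn_integral_cong ennreal_mult) (simp_all add: less_imp_le)
    also have "\<dots> = ennreal 2 * (\<integral>\<^sup>+ x. ennreal (C t x / (g x)\<^sup>2) \<partial>M)"
      by (rule nn_integral_cmult) measurable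
    also have "\<dots> \<le> ennreal 2 * ennreal (4 * (1 + S0))"
      by (intro mult_left_mono gC t) auto
    also have "\<dots> = ennreal (2 * (4 * (1 + S0)))"
      using S0 by (intro ennreal_mult[symmetric]) auto
    finally show ?thesis by simp
  qed
  with g show ?thesis unfolding F_def S0_def by blast
qed

end

subsection \<open>Passage to all vectors\<close>

lemma powr_midpoint_le:
  fixes u v q :: real
  assumes "0 < u" "0 < v" "1 \<le> q"
  shows "((u + v) / 2) powr q \<le> (u powr q + v powr q) / 2"
  using convex_onD[OF powr_convex[OF assms(3)], of "1 / 2" u v] assms
  by (simp add: add_divide_distrib)

text \<open>Together with \<open>powr_midpoint_le\<close> this makes the admissible multipliers
  midpoint convex. The value \<open>1 / (u * v)\<close> lies between the two sides, by the
  inequality of the means for \<open>u\<close>, \<open>v\<close> and for the squares of their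
  inverses.\<close>

lemma inverse_square_midpoint_le:
  fixes u v :: real
  assumes "0 < u" "0 < v"
  shows "1 / ((u + v) / 2)\<^sup>2 \<le> (1 / u\<^sup>2 + 1 / v\<^sup>2) / 2"
proof -
  have "u * v \<le> ((u + v) / 2)\<^sup>2"
    using zero_le_power2[of "u - v"] by (simp add: power2_eq_square field_simps)
  then have "1 / ((u + v) / 2)\<^sup>2 \<le> 1 / (u * v)"
    using assms by (intro divide_left_mono) auto
  also have "\<dots> = (1 / u) * (1 / v)" by simp
  also have "\<dots> \<le> ((1 / u)\<^sup>2 + (1 / v)\<^sup>2) / 2"
    using sum_squares_bound[of "1 / u" "1 / v"] by simp
  finally show ?thesis by (simp add: power_divide)
qed

text \<open>Such weights provide a positive function of finite cell norm and an equivalent finite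
  measure. Powers of 1/2 along an enumeration do this, with total at most that of the full geometric
  series.\<close>

lemma exists_summable_weights:
  "\<exists>c :: 'a::countable \<Rightarrow> real. (\<forall>a. 0 < c a) \<and> (\<integral>\<^sup>+ a. ennreal (c a) \<partial>count_space UNIV) \<le> 2"
proof (intro exI conjI allI)
  let ?c = "\<lambda>a :: 'a. (1 / 2 :: real) ^ to_nat a"
  show "0 < ?c a" for a by simp
  have "(\<integral>\<^sup>+ a. ennreal (?c a) \<partial>count_space UNIV) =
      (\<integral>\<^sup>+ n. ennreal ((1 / 2) ^ n) \<partial>count_space (range (to_nat :: 'a \<Rightarrow> nat)))"
    by (intro nn_integral_bij_count_space) (simp add: inj_on_imp_bij_betw)
  also have "\<dots> \<le> (\<integral>\<^sup>+ n. ennreal ((1 / 2) ^ n) \<partial>count_space UNIV)"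
    by (subst nn_integral_count_space_indicator)
       (auto intro!: nn_integral_mono simp: indicator_def)
  also have "\<dots> = (\<Sum>n. ennreal ((1 / 2) ^ n))"
    by (rule nn_integral_count_space_nat)
  also have "\<dots> = ennreal 2"
    using geometric_sums[of "1 / 2 :: real"] by (subst suminf_ennreal2) (auto simp: sums_iff)
  finally show "(\<integral>\<^sup>+ a. ennreal (?c a) \<partial>count_space UNIV) \<le> 2" by simp
qed

context cells
begin

lemma cell_norm_const:
  assumes "0 < r" "\<And>a. 0 < c a"
  shows "cell_norm r (\<lambda>x. c (k x)) = (\<integral>\<^sup>+ a. ennreal (c a) \<partial>count_space UNIV)"
  unfolding cell_norm_def
proof (rule nn_integral_cong)
  fix a
  have "cell_int (\<lambda>x. ennreal (c (k x) powr r)) a = cell_int (\<lambda>x. ennreal (c a powr r)) a"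
    by (rule cell_int_cong) simp
  also have "\<dots> = ennreal (c a powr r)" by (rule cell_int_const)
  finally show "ennreal_powr (cell_int (\<lambda>x. ennreal (c (k x) powr r)) a) (1 / r) = ennreal (c a)"
    using assms(1) assms(2)[of a] by (simp add: ennreal_powr_ennreal powr_powr)
qed

text \<open>Since \<open>q \<ge> 2\<close>, the square of \<open>g\<close> is at most
  \<open>1 + g x powr q\<close>, so the cell bound places the multipliers in a ball of a weighted
  L^2 space.\<close>

lemma nn_integral_square_le_cell_bound:
  assumes [measurable]: "g \<in> borel_measurable M" and q: "2 \<le> q" and c: "\<And>a. 0 \<le> c a"
    and g: "\<And>x. 0 < g x" "\<And>a. cell_int (\<lambda>x. ennreal (g x powr q)) a \<le> 1"
  shows "(\<integral>\<^sup>+ x. ennreal (c (k x)) * ennreal ((g x)\<^sup>2) \<partial>M) \<le> 2 * (\<integral>\<^sup>+ a. ennreal (c a) \<partial>count_space UNIV)"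
proof -
  have pw: "(g x)\<^sup>2 \<le> 1 + g x powr q" for x
  proof (cases "g x \<le> 1")
    case True
    then have "(g x)\<^sup>2 \<le> 1" using g(1)[of x] by (simp add: power_le_one)
    then show ?thesis by (simp add: add_increasing2)
  next
    case False
    then have "g x powr 2 \<le> g x powr q" using q by (intro powr_mono) auto
    then show ?thesis using g(1)[of x] by simp
  qed
  have "cell_int (\<lambda>x. ennreal (c (k x)) * ennreal ((g x)\<^sup>2)) a \<le> ennreal (c a) * 2" for a
  proof -
    have "cell_int (\<lambda>x. ennreal (c (k x)) * ennreal ((g x)\<^sup>2)) a \<le>
        cell_int (\<lambda>x. ennreal (c a) * (1 + ennreal (g x powr q))) a"
      using pw by (intro cell_int_mono) (auto intro!: mult_left_mono simp: ennreal_leI simp flip: ennreal_1 ennreal_plus)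
    also have "\<dots> = ennreal (c a) * (1 + cell_int (\<lambda>x. ennreal (g x powr q)) a)"
      by (simp add: cell_int_cmult cell_int_add cell_int_const)
    also have "\<dots> \<le> ennreal (c a) * (1 + 1)"
      by (intro mult_left_mono add_left_mono g) auto
    finally show ?thesis by simp
  qed
  then have "(\<integral>\<^sup>+ a. cell_int (\<lambda>x. ennreal (c (k x)) * ennreal ((g x)\<^sup>2)) a \<partial>count_space UNIV) \<le>
      (\<integral>\<^sup>+ a. ennreal (c a) * 2 \<partial>count_space UNIV)"
    by (intro nn_integral_mono)
  then show ?thesis
    by (subst (asm) nn_integral_cell_int) (auto simp: nn_integral_multc mult.commute)
qed

text \<open>The multiplier is an almost everywhere limit of strictly positive functions; hence
  positivity is claimed only almost everywhere, next to nonnegativity at every point.\<close>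

theorem exists_multiplier:
  fixes X :: "'h::real_normed_vector \<Rightarrow> 'b \<Rightarrow> complex"
  assumes r: "1 / 2 < r" "r < 1"
    and parallelogram:
      "\<And>u v :: 'h. (norm (u + v))\<^sup>2 + (norm (u - v))\<^sup>2 = 2 * (norm u)\<^sup>2 + 2 * (norm v)\<^sup>2"
    and meas [measurable]: "\<And>u. X u \<in> borel_measurable M"
    and add: "\<And>u v. AE x in M. X (u + v) x = X u x + X v x"
    and scale: "\<And>c u. AE x in M. X (c *\<^sub>R u) x = c *\<^sub>R X u x"
    and B: "0 \<le> B" "\<And>u. cell_norm r (\<lambda>x. (norm (X u x))\<^sup>2) \<le> ennreal (B * (norm u)\<^sup>2)"
  shows "\<exists>g C. g \<in> borel_measurable M \<and> (\<forall>x. 0 \<le> g x) \<and> (AE x in M. 0 < g x) \<and>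
    (\<forall>a. cell_int (\<lambda>x. ennreal (g x powr (2 * r / (1 - r)))) a \<le> 1) \<and>
    (\<forall>f. norm f \<le> 1 \<longrightarrow> (\<integral>\<^sup>+ x. ennreal ((norm (X f x))\<^sup>2 / (g x)\<^sup>2) \<partial>M) \<le> ennreal C)"
proof -
  define q where "q = 2 * r / (1 - r)"
  \<comment> \<open>Here \<open>1 / 2 < r\<close>, that is \<open>p > 1\<close>, enters.\<close>
  have q: "2 \<le> q" using r by (simp add: q_def field_simps)
  have r0: "0 < r" using r by simp
  obtain c :: "'a \<Rightarrow> real" where c: "\<And>a. 0 < c a" "(\<integral>\<^sup>+ a. ennreal (c a) \<partial>count_space UNIV) \<le> 2"
    using exists_summable_weights by blast
  define \<phi> where "\<phi> x = c (k x)" for x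
  have \<phi>_meas [measurable]: "\<phi> \<in> borel_measurable M" unfolding \<phi>_def by measurable
  have \<phi>_pos: "0 < \<phi> x" for x by (simp add: \<phi>_def c)
  have \<phi>_norm: "cell_norm r \<phi> \<le> ennreal 2"
    using cell_norm_const[OF r0, of c] c by (simp add: \<phi>_def[abs_def])
  \<comment> \<open>\<open>N\<close> has the null sets of \<open>M\<close> but finite mass, and the
    admissible multipliers are bounded in its L^2 space. Its density is the summand
    \<open>\<phi>\<close> itself.\<close>
  define N where "N = density M \<phi>"
  have sets_N [measurable_cong]: "sets N = sets M" by (simp add: N_def)
  have AE_N: "(AE x in N. Q x) \<longleftrightarrow> (AE x in M. Q x)" for Q
    unfolding N_def by (subst AE_density) (auto simp: \<phi>_pos)
  define C where "C = 8 * (1 + 2 powr (1 / r) * (12 powr (1 / r) * B + 2))"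
  define F where "F f x = (norm (X f x))\<^sup>2 + \<phi> x" for f x
  have [measurable]: "F f \<in> borel_measurable M" for f unfolding F_def by measurable
  have F_pos: "0 < F f x" for f x using \<phi>_pos[of x] by (simp add: F_def add_nonneg_pos)
  define P where "P A = {g. g \<in> borel_measurable M \<and> (\<forall>x. 0 < g x) \<and>
    (\<forall>a. cell_int (\<lambda>x. ennreal (g x powr q)) a \<le> 1) \<and>
    (\<forall>f\<in>A. (\<integral>\<^sup>+ x. ennreal (F f x / (g x)\<^sup>2) \<partial>M) \<le> ennreal C)}" for A
  have N_int: "(\<integral>\<^sup>+ x. f x \<partial>N) = (\<integral>\<^sup>+ x. ennreal (c (k x)) * f x \<partial>M)" if "f \<in> borel_measurable M" for f
    unfolding N_def using that by (subst nn_integral_density) (auto simp: \<phi>_def)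
  have fin_N: "finite_measure N"
  proof
    have "emeasure N (space N) = (\<integral>\<^sup>+ x. ennreal (c (k x)) * 1 \<partial>M)"
      by (subst N_int[symmetric]) auto
    also have "\<dots> = (\<integral>\<^sup>+ a. cell_int (\<lambda>x. ennreal (c (k x))) a \<partial>count_space UNIV)"
      by (subst nn_integral_cell_int) auto
    also have "\<dots> = (\<integral>\<^sup>+ a. ennreal (c a) \<partial>count_space UNIV)"
    proof (rule nn_integral_cong)
      fix a
      have "cell_int (\<lambda>x. ennreal (c (k x))) a = cell_int (\<lambda>x. ennreal (c a)) a"
        by (rule cell_int_cong) simp
      then show "cell_int (\<lambda>x. ennreal (c (k x))) a = ennreal (c a)" by (simp add: cell_int_const)
    qed
    also have "\<dots> < \<infinity>" by (rule le_less_trans[OF c(2)]) (simp add: less_top[symmetric])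
    finally show "emeasure N (space N) \<noteq> \<infinity>" by simp
  qed
  define I where "I = {f :: 'h. norm f \<le> 1}"
  have "\<exists>g\<in>borel_measurable N. \<forall>f\<in>I. \<exists>h. (\<forall>n. h n \<in> P {f}) \<and> (AE x in N. (\<lambda>n. h n x) \<longlonglongrightarrow> g x)"
  proof (rule directed_midpoint_convex_limit[OF fin_N])
    show "P A' \<subseteq> P A" if "A \<subseteq> A'" for A A'
      using that by (auto simp: P_def)
    show "P A \<noteq> {}" if "finite A" "A \<subseteq> I" for A
    proof -
      \<comment> \<open>The vector \<open>0\<close> is inserted because
        \<open>exists_multiplier_finite\<close> asks for a nonempty set, while \<open>A\<close> may
        be empty.\<close>
      have "\<exists>g. g \<in> borel_measurable M \<and> (\<forall>x. 0 < g x) \<and>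
        (\<forall>a. cell_int (\<lambda>x. ennreal (g x powr (2 * r / (1 - r)))) a \<le> 1) \<and>
        (\<forall>f\<in>insert 0 A. (\<integral>\<^sup>+ x. ennreal (((norm (X f x))\<^sup>2 + \<phi> x) / (g x)\<^sup>2) \<partial>M) \<le>
          ennreal (8 * (1 + 2 powr (1 / r) * (12 powr (1 / r) * B + 2))))"
        using that by (intro exists_multiplier_finite[OF r0 r(2) parallelogram meas add scale B \<phi>_meas \<phi>_pos \<phi>_norm])
          (auto simp: I_def)
      then have "\<exists>g. g \<in> P A" unfolding P_def F_def C_def q_def by fast
      then show ?thesis by blast
    qed
    show "g \<in> borel_measurable N" if "g \<in> P A" for A g
      using that sets_N by (simp add: P_def cong: measurable_cong_sets)
    show "(\<lambda>x. (g x + h x) / 2) \<in> P A" if gh: "g \<in> P A" "h \<in> P A" for A g h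
    proof -
      have [measurable]: "g \<in> borel_measurable M" "h \<in> borel_measurable M"
        and pos: "0 < g x" "0 < h x" for x using gh by (auto simp: P_def)
      have half: "ennreal (1 / 2) * (t + u) \<le> s" if "t \<le> s" "u \<le> s" for s t u
      proof -
        have "ennreal (1 / 2) * (t + u) \<le> ennreal (1 / 2) * (s + s)"
          using that by (intro mult_left_mono add_mono) auto
        also have "\<dots> = (ennreal (1 / 2) * 2) * s" by (simp add: mult.assoc mult_2)
        also have "ennreal (1 / 2) * 2 = 1"
          using ennreal_mult[of "1 / 2" 2] by simp
        finally show ?thesis by simp
      qed
      have half_eq: "ennreal (1 / 2 * (t + u)) = ennreal (1 / 2) * (ennreal t + ennreal u)"
        if "0 \<le> t" "0 \<le> u" for t u
        by (subst ennreal_mult) (use that in auto)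
      have "cell_int (\<lambda>x. ennreal (((g x + h x) / 2) powr q)) a \<le> 1" for a
      proof -
        have "cell_int (\<lambda>x. ennreal (((g x + h x) / 2) powr q)) a \<le>
            cell_int (\<lambda>x. ennreal (1 / 2) * (ennreal (g x powr q) + ennreal (h x powr q))) a"
        proof (rule cell_int_mono)
          fix x
          have "((g x + h x) / 2) powr q \<le> 1 / 2 * (g x powr q + h x powr q)"
            using powr_midpoint_le[of "g x" "h x" q] pos q by simp
          then show "ennreal (((g x + h x) / 2) powr q) \<le> ennreal (1 / 2) * (ennreal (g x powr q) + ennreal (h x powr q))"
            by (subst half_eq[symmetric]) (auto intro: ennreal_leI)
        qed
        also have "\<dots> = ennreal (1 / 2) * (cell_int (\<lambda>x. ennreal (g x powr q)) a + cell_int (\<lambda>x. ennreal (h x powr q)) a)"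
          by (subst cell_int_cmult, measurable) (subst cell_int_add, measurable)
        also have "\<dots> \<le> 1"
          using gh by (intro half) (auto simp: P_def)
        finally show ?thesis .
      qed
      moreover have "(\<integral>\<^sup>+ x. ennreal (F f x / ((g x + h x) / 2)\<^sup>2) \<partial>M) \<le> ennreal C" if "f \<in> A" for f
      proof -
        have "(\<integral>\<^sup>+ x. ennreal (F f x / ((g x + h x) / 2)\<^sup>2) \<partial>M) \<le>
           (\<integral>\<^sup>+ x. ennreal (1 / 2) * (ennreal (F f x / (g x)\<^sup>2) + ennreal (F f x / (h x)\<^sup>2)) \<partial>M)"
        proof (rule nn_integral_mono)
          fix x
          have "F f x * (1 / ((g x + h x) / 2)\<^sup>2) \<le> F f x * ((1 / (g x)\<^sup>2 + 1 / (h x)\<^sup>2) / 2)"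
            using F_pos[of f x] by (intro mult_left_mono inverse_square_midpoint_le pos) auto
          also have "\<dots> = 1 / 2 * (F f x / (g x)\<^sup>2 + F f x / (h x)\<^sup>2)"
            by (simp add: distrib_left add_divide_distrib)
          finally have "F f x / ((g x + h x) / 2)\<^sup>2 \<le> 1 / 2 * (F f x / (g x)\<^sup>2 + F f x / (h x)\<^sup>2)"
            by simp
          then show "ennreal (F f x / ((g x + h x) / 2)\<^sup>2) \<le> ennreal (1 / 2) * (ennreal (F f x / (g x)\<^sup>2) + ennreal (F f x / (h x)\<^sup>2))"
            using F_pos[of f x] by (subst half_eq[symmetric]) (auto intro: ennreal_leI)
        qed
        also have "\<dots> = ennreal (1 / 2) * ((\<integral>\<^sup>+ x. ennreal (F f x / (g x)\<^sup>2) \<partial>M) + (\<integral>\<^sup>+ x. ennreal (F f x / (h x)\<^sup>2) \<partial>M))"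
          by (subst nn_integral_cmult, measurable) (subst nn_integral_add, measurable)
        also have "\<dots> \<le> ennreal C"
          using gh that by (intro half) (auto simp: P_def)
        finally show ?thesis .
      qed
      ultimately show ?thesis
        using pos by (auto simp: P_def add_pos_pos)
    qed
    show "(\<integral>\<^sup>+ x. ennreal ((g x)\<^sup>2) \<partial>N) \<le> ennreal 4" if "g \<in> P A" for A g
    proof -
      have [measurable]: "g \<in> borel_measurable M" using that by (auto simp: P_def)
      have "(\<integral>\<^sup>+ x. ennreal ((g x)\<^sup>2) \<partial>N) = (\<integral>\<^sup>+ x. ennreal (c (k x)) * ennreal ((g x)\<^sup>2) \<partial>M)"
        by (rule N_int) measurable
      also have "\<dots> \<le> 2 * (\<integral>\<^sup>+ a. ennreal (c a) \<partial>count_space UNIV)"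
        using that c by (intro nn_integral_square_le_cell_bound[OF _ q]) (auto simp: P_def less_imp_le)
      also have "\<dots> \<le> 2 * 2" by (intro mult_left_mono c) auto
      also have "\<dots> = ennreal 4" by simp
      finally show ?thesis .
    qed
  qed
  then obtain g0 where "g0 \<in> borel_measurable N"
    and g0: "\<And>f. f \<in> I \<Longrightarrow> \<exists>h. (\<forall>n. h n \<in> P {f}) \<and> (AE x in N. (\<lambda>n. h n x) \<longlonglongrightarrow> g0 x)"
    by blast
  then have [measurable]: "g0 \<in> borel_measurable M"
    using sets_N by (simp cong: measurable_cong_sets)
  \<comment> \<open>The limit \<open>g0\<close> is nonnegative only almost everywhere. The
    approximants are positive, so they converge almost everywhere to the absolute value as
    well.\<close>
  define g where "g x = \<bar>g0 x\<bar>" for x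
  have g_meas [measurable]: "g \<in> borel_measurable M" unfolding g_def by measurable
  have g_nn: "0 \<le> g x" for x by (simp add: g_def)
  have g_lim: "\<exists>h. (\<forall>n. h n \<in> P {f}) \<and> (AE x in M. (\<lambda>n. h n x) \<longlonglongrightarrow> g x)" if f: "f \<in> I" for f
  proof -
    obtain h where h: "\<And>n. h n \<in> P {f}" "AE x in M. (\<lambda>n. h n x) \<longlonglongrightarrow> g0 x"
      using g0[OF f] unfolding AE_N by blast
    have "AE x in M. (\<lambda>n. h n x) \<longlonglongrightarrow> g x"
      using h(2)
    proof eventually_elim
      case (elim x)
      then have "(\<lambda>n. \<bar>h n x\<bar>) \<longlonglongrightarrow> g x" unfolding g_def by (rule tendsto_rabs)
      moreover have "\<bar>h n x\<bar> = h n x" for n using h(1)[of n] by (auto simp: P_def less_imp_le)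
      ultimately show ?case by simp
    qed
    with h(1) show ?thesis by blast
  qed
  have cell: "cell_int (\<lambda>x. ennreal (g x powr q)) a \<le> 1" for a
  proof -
    \<comment> \<open>The cell bound is part of every \<open>P {f}\<close>, so the vector
      \<open>0\<close> serves as well as any other.\<close>
    obtain h where h: "\<And>n. h n \<in> P {0}" "AE x in M. (\<lambda>n. h n x) \<longlonglongrightarrow> g x"
      using g_lim[of 0] by (auto simp: I_def)
    have [measurable]: "h n \<in> borel_measurable M" for n using h(1)[of n] by (auto simp: P_def)
    have "cell_int (\<lambda>x. ennreal (g x powr q)) a = (\<integral>\<^sup>+ x. liminf (\<lambda>n. ennreal (h n x powr q) * indicator (k -` {a}) x) \<partial>M)"
      unfolding cell_int_def
    proof (rule nn_integral_cong_AE, use h(2) in eventually_elim)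
      case (elim x)
      have "(\<lambda>n. h n x powr q) \<longlonglongrightarrow> g x powr q"
        using elim q h(1) by (intro tendsto_powr' tendsto_const) (auto simp: P_def less_imp_le)
      then have "(\<lambda>n. ennreal (h n x powr q) * indicator (k -` {a}) x) \<longlonglongrightarrow> ennreal (g x powr q) * indicator (k -` {a}) x"
        by (cases "k x = a") (auto simp: tendsto_ennrealI)
      then show ?case by (simp add: lim_imp_Liminf)
    qed
    also have "\<dots> \<le> liminf (\<lambda>n. \<integral>\<^sup>+ x. ennreal (h n x powr q) * indicator (k -` {a}) x \<partial>M)"
      by (rule nn_integral_liminf) measurable
    also have "\<dots> \<le> liminf (\<lambda>n. 1 :: ennreal)"
      using h(1) by (intro Liminf_mono always_eventually) (auto simp: P_def cell_int_def)
    also have "\<dots> = 1" by (simp add: Liminf_const)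
    finally show ?thesis .
  qed
  \<comment> \<open>The quotient is written with \<open>inverse\<close> on \<open>ennreal\<close>,
    which is continuous and infinite at \<open>0\<close>. Real division would give \<open>0\<close>
    where \<open>g\<close> vanishes and lose the passage to the limit there.\<close>
  have lim: "(\<integral>\<^sup>+ x. ennreal (F f x) * (inverse (ennreal (g x)) * inverse (ennreal (g x))) \<partial>M) \<le> ennreal C"
    if f: "f \<in> I" for f
  proof -
    obtain h where h: "\<And>n. h n \<in> P {f}" "AE x in M. (\<lambda>n. h n x) \<longlonglongrightarrow> g x"
      using g_lim[OF f] by auto
    have [measurable]: "h n \<in> borel_measurable M" for n using h(1)[of n] by (auto simp: P_def)
    have pos: "0 < h n x" for n x using h(1)[of n] by (auto simp: P_def)
    have "(\<integral>\<^sup>+ x. ennreal (F f x) * (inverse (ennreal (g x)) * inverse (ennreal (g x))) \<partial>M) =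
       (\<integral>\<^sup>+ x. liminf (\<lambda>n. ennreal (F f x / (h n x)\<^sup>2)) \<partial>M)"
    proof (rule nn_integral_cong_AE, use h(2) in eventually_elim)
      case (elim x)
      have "continuous_on UNIV (inverse :: ennreal \<Rightarrow> ennreal)"
        by (intro continuous_on_inverse_ennreal continuous_on_id)
      then have inv: "(\<lambda>n. inverse (ennreal (h n x))) \<longlonglongrightarrow> inverse (ennreal (g x))"
        using elim by (auto intro: continuous_on_tendsto_compose[where s=UNIV] tendsto_ennrealI)
      have "(\<lambda>n. ennreal (F f x) * (inverse (ennreal (h n x)) * inverse (ennreal (h n x)))) \<longlonglongrightarrow>
        ennreal (F f x) * (inverse (ennreal (g x)) * inverse (ennreal (g x)))"
        using F_pos[of f x] by (intro tendsto_mult_ennreal tendsto_const inv) (auto simp: ennreal_eq_0_iff not_le)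
      moreover have "ennreal (F f x) * (inverse (ennreal (h n x)) * inverse (ennreal (h n x))) = ennreal (F f x / (h n x)\<^sup>2)" for n
        using pos[of n x] F_pos[of f x]
        by (simp add: inverse_ennreal power2_eq_square divide_inverse flip: ennreal_mult)
      ultimately show ?case by (simp add: lim_imp_Liminf)
    qed
    also have "\<dots> \<le> liminf (\<lambda>n. \<integral>\<^sup>+ x. ennreal (F f x / (h n x)\<^sup>2) \<partial>M)"
      by (rule nn_integral_liminf) measurable
    also have "\<dots> \<le> liminf (\<lambda>n. ennreal C)"
      using h(1) by (intro Liminf_mono always_eventually) (auto simp: P_def)
    also have "\<dots> = ennreal C" by (simp add: Liminf_const)
    finally show ?thesis .
  qed
  \<comment> \<open>Where \<open>g\<close> vanishes, the integrand of \<open>lim\<close> is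
    infinite, because \<open>F 0 x\<close> is at least \<open>\<phi> x > 0\<close>.\<close>
  have "AE x in M. 0 < g x"
  proof -
    have "(\<integral>\<^sup>+ x. ennreal (F 0 x) * (inverse (ennreal (g x)) * inverse (ennreal (g x))) \<partial>M) \<noteq> \<infinity>"
      using lim[of 0] by (auto simp: I_def top_unique)
    then have "AE x in M. ennreal (F 0 x) * (inverse (ennreal (g x)) * inverse (ennreal (g x))) \<noteq> \<infinity>"
      by (intro nn_integral_noteq_infinite) measurable
    then show ?thesis
    proof eventually_elim
      case (elim x)
      then have "g x \<noteq> 0"
        using F_pos[of 0 x] by (auto simp: ennreal_mult_top ennreal_eq_0_iff)
      then show ?case using g_nn[of x] by simp
    qed
  qed
  moreover have "(\<integral>\<^sup>+ x. ennreal ((norm (X f x))\<^sup>2 / (g x)\<^sup>2) \<partial>M) \<le> ennreal C" if f: "norm f \<le> 1" for f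
  proof -
    have "(\<integral>\<^sup>+ x. ennreal ((norm (X f x))\<^sup>2 / (g x)\<^sup>2) \<partial>M) \<le>
      (\<integral>\<^sup>+ x. ennreal (F f x) * (inverse (ennreal (g x)) * inverse (ennreal (g x))) \<partial>M)"
    proof (rule nn_integral_mono)
      fix x
      show "ennreal ((norm (X f x))\<^sup>2 / (g x)\<^sup>2) \<le> ennreal (F f x) * (inverse (ennreal (g x)) * inverse (ennreal (g x)))"
      \<comment> \<open>At a zero of \<open>g\<close> the real quotient on the left is
        \<open>0\<close> by convention.\<close>
      proof (cases "g x = 0")
        case False
        then have "0 < g x" using g_nn[of x] by simp
        then have "ennreal (F f x) * (inverse (ennreal (g x)) * inverse (ennreal (g x))) = ennreal (F f x / (g x)\<^sup>2)"
          using F_pos[of f x]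
          by (simp add: inverse_ennreal power2_eq_square divide_inverse flip: ennreal_mult)
        moreover have "(norm (X f x))\<^sup>2 / (g x)\<^sup>2 \<le> F f x / (g x)\<^sup>2"
          using \<phi>_pos[of x] by (intro divide_right_mono) (auto simp: F_def)
        ultimately show ?thesis by (simp add: ennreal_leI)
      qed simp
    qed
    also have "\<dots> \<le> ennreal C" using f by (intro lim) (simp add: I_def)
    finally show ?thesis .
  qed
  ultimately show ?thesis
    using g_meas g_nn cell unfolding q_def by blast
qed

end

subsection \<open>Factorization\<close>

text \<open>Sesquilinearity cancels the mixed terms. The difference is expanded as
  \<open>u + - v\<close>, with negation obtained as scaling by \<open>-1\<close>.\<close>

lemma chilbert_parallelogram:
  fixes u v :: "'h::chilbert_space"
  shows "(norm (u + v))\<^sup>2 + (norm (u - v))\<^sup>2 = 2 * (norm u)\<^sup>2 + 2 * (norm v)\<^sup>2"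
proof -
  have add_left: "cinner (x + y) z = cinner x z + cinner y z" for x y z :: 'h
    by (metis cinner_add_right cinner_commute complex_cnj_add)
  have minus_right: "cinner x (- y) = - cinner x y" for x y :: 'h
  proof -
    have "cinner x (- y) = cinner x (- 1 *\<^sub>C y)"
      using scaleR_scaleC[of "- 1" y] by simp
    then show ?thesis by (simp only: cinner_scaleC_right mult_minus1)
  qed
  have minus_left: "cinner (- y) x = - cinner y x" for x y :: 'h
    by (metis cinner_commute complex_cnj_minus minus_right)
  have "complex_of_real ((norm (u + v))\<^sup>2 + (norm (u - v))\<^sup>2) = cinner (u + v) (u + v) + cinner (u + - v) (u + - v)"
    by (simp add: cinner_same)
  also have "\<dots> = 2 * cinner u u + 2 * cinner v v"
    by (simp only: cinner_add_right add_left minus_left minus_right) simp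
  also have "\<dots> = complex_of_real (2 * (norm u)\<^sup>2 + 2 * (norm v)\<^sup>2)"
    by (simp add: cinner_same)
  finally show ?thesis by (simp only: of_real_eq_iff)
qed

section \<open>Representatives of almost everywhere classes\<close>

lemma ae_eq_refl_iff: "ae_eq f f \<longleftrightarrow> f \<in> borel_measurable lebesgue"
  by (auto simp: ae_eq_def)

lemma measurable_rep_L0 [measurable]: "rep_L0 F \<in> borel_measurable lebesgue"
  using Quotient3_rep_reflp[OF Quotient3_L0, of F] by (simp add: ae_eq_refl_iff)

lemma abs_rep_L0: "abs_L0 (rep_L0 F) = F"
  by (rule Quotient3_abs_rep[OF Quotient3_L0])

lemma abs_L0_eqD: "f \<in> borel_measurable lebesgue \<Longrightarrow> g \<in> borel_measurable lebesgue \<Longrightarrow> abs_L0 f = abs_L0 g \<Longrightarrow> AE x in lebesgue. f x = g x"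
  using Quotient3_rel[OF Quotient3_L0, of f g] by (auto simp: ae_eq_def)

lemma abs_L0_eqI: "f \<in> borel_measurable lebesgue \<Longrightarrow> g \<in> borel_measurable lebesgue \<Longrightarrow> AE x in lebesgue. f x = g x \<Longrightarrow> abs_L0 f = abs_L0 g"
  using Quotient3_rel[OF Quotient3_L0, of f g] by (auto simp: ae_eq_def)

text \<open>Chosen representatives respect sums only up to a null set, whence the almost everywhere
  form of linearity in the multiplier lemmas.\<close>

lemma rep_L0_add: "AE x in lebesgue. rep_L0 (F + G) x = rep_L0 F x + rep_L0 G x"
proof (rule abs_L0_eqD)
  have "abs_L0 (rep_L0 F) + abs_L0 (rep_L0 G) = abs_L0 (\<lambda>x. rep_L0 F x + rep_L0 G x)"
    by (rule plus_L0.abs_eq) (simp_all add: ae_eq_refl_iff)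
  then show "abs_L0 (rep_L0 (F + G)) = abs_L0 (\<lambda>x. rep_L0 F x + rep_L0 G x)"
    by (simp add: abs_rep_L0)
qed measurable

lemma rep_L0_scaleC: "AE x in lebesgue. rep_L0 (c *\<^sub>C F) x = c * rep_L0 F x"
proof (rule abs_L0_eqD)
  have "c *\<^sub>C abs_L0 (rep_L0 F) = abs_L0 (\<lambda>x. c * rep_L0 F x)"
    by (rule scaleC_L0.abs_eq) (simp_all add: ae_eq_refl_iff)
  then show "abs_L0 (rep_L0 (c *\<^sub>C F)) = abs_L0 (\<lambda>x. c * rep_L0 F x)"
    by (simp add: abs_rep_L0)
qed measurable

lemma times_abs_L0:
  "f \<in> borel_measurable lebesgue \<Longrightarrow> g \<in> borel_measurable lebesgue \<Longrightarrow>
    abs_L0 f * abs_L0 g = abs_L0 (\<lambda>x. f x * g x)"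
  by (rule times_L0.abs_eq) (simp_all add: ae_eq_refl_iff)

lemma scaleC_abs_L0: "f \<in> borel_measurable lebesgue \<Longrightarrow> c *\<^sub>C abs_L0 f = abs_L0 (\<lambda>x. c * f x)"
  by (rule scaleC_L0.abs_eq) (simp_all add: ae_eq_refl_iff)

lemma times_scaleC_L0: "F * (c *\<^sub>C G) = c *\<^sub>C (F * G :: 'n::finite L0)"
  by transfer (auto simp: ae_eq_def algebra_simps)

lemma Lp_norm_abs_L0:
  "f \<in> borel_measurable lebesgue \<Longrightarrow>
    Lp_norm p (abs_L0 f) = ennreal_powr (\<integral>\<^sup>+ x. ennreal (norm (f x) powr p) \<partial>lebesgue) (1 / p)"
  by (rule Lp_norm.abs_eq) (simp add: ae_eq_refl_iff)

lemma Lp_norm_scaleC: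
  assumes p: "0 < p" and c: "c \<noteq> 0"
  shows "Lp_norm p (c *\<^sub>C F) = ennreal (norm c) * Lp_norm p F"
proof -
  have "Lp_norm p (c *\<^sub>C abs_L0 (rep_L0 F)) = ennreal (norm c) * Lp_norm p (abs_L0 (rep_L0 F))"
  proof -
    have "(\<integral>\<^sup>+ x. ennreal (norm (c * rep_L0 F x) powr p) \<partial>lebesgue) =
        ennreal (norm c powr p) * (\<integral>\<^sup>+ x. ennreal (norm (rep_L0 F x) powr p) \<partial>lebesgue)"
      by (subst nn_integral_cmult[symmetric])
         (auto simp: norm_mult powr_mult ennreal_mult intro!: nn_integral_cong)
    then show ?thesis
      using p c by (simp add: scaleC_abs_L0 Lp_norm_abs_L0 ennreal_powr_cmult powr_powr)
  qed
  then show ?thesis by (simp only: abs_rep_L0)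
qed

section \<open>The unit cubes as cells, and the norms in terms of cells\<close>

definition cube_index :: "real ^ 'n \<Rightarrow> int ^ 'n" where
  "cube_index x = (\<chi> i. \<lceil>x $ i - 1 / 2\<rceil>)"

text \<open>The ceiling assigns a coordinate \<open>z + 1 / 2\<close> to the integer
  \<open>z\<close>, in agreement with cubes that are open below and closed above.\<close>

lemma cube_index_eq_iff: "cube_index x = a \<longleftrightarrow> x \<in> unit_cube a"
proof -
  have "\<lceil>t - 1 / 2\<rceil> = z \<longleftrightarrow> real_of_int z - 1 / 2 < t \<and> t \<le> real_of_int z + 1 / 2" for t z
    unfolding ceiling_eq_iff by auto
  then show ?thesis by (simp add: cube_index_def unit_cube_def vec_eq_iff)
qed

text \<open>The half-open cube is squeezed between an open and a closed box with sides of length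
  one.\<close>

lemma emeasure_unit_cube: "emeasure lebesgue (unit_cube a :: (real ^ 'n) set) = 1"
proof -
  define l u :: "real ^ 'n" where "l = (\<chi> i. real_of_int (a $ i) - 1 / 2)" and "u = (\<chi> i. real_of_int (a $ i) + 1 / 2)"
  have b: "(u - l) \<bullet> b = 1" "l \<bullet> b \<le> u \<bullet> b" if "b \<in> Basis" for b
    using that by (auto simp: Basis_vec_def inner_axis l_def u_def)
  have sub: "box l u \<subseteq> unit_cube a" "unit_cube a \<subseteq> cbox l u"
    by (auto simp: unit_cube_def l_def u_def mem_box_cart less_imp_le)
  have "emeasure lebesgue (box l u) \<le> emeasure lebesgue (unit_cube a)"
    by (rule emeasure_mono[OF sub(1) unit_cube_measurable])
  moreover have "emeasure lebesgue (unit_cube a) \<le> emeasure lebesgue (cbox l u)"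
    by (rule emeasure_mono[OF sub(2)]) simp
  moreover have "emeasure lebesgue (box l u) = 1" "emeasure lebesgue (cbox l u) = 1"
    using b by (simp_all add: emeasure_lborel_box emeasure_lborel_cbox)
  ultimately show ?thesis by (intro antisym) auto
qed

lemma cells_lebesgue: "cells (lebesgue :: (real ^ 'n::finite) measure) cube_index"
proof
  have *: "cube_index -` {a} \<inter> space lebesgue = (unit_cube a :: (real ^ 'n) set)" for a
    by (rule set_eqI) (simp add: cube_index_eq_iff)
  show "cube_index \<in> lebesgue \<rightarrow>\<^sub>M (count_space UNIV :: (int ^ 'n) measure)"
    by (subst measurable_count_space_eq2_countable)
       (auto simp: * unit_cube_measurable simp del: space_completion)
  show "emeasure lebesgue (cube_index -` {a} \<inter> space (lebesgue :: (real ^ 'n) measure)) = 1" for a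
    unfolding * by (rule emeasure_unit_cube)
qed

text \<open>Connects the sum in \<open>l2_Lp_norm\<close> with \<open>cell_norm\<close>. The finite
  sets \<open>F n\<close> exhaust the index type: monotone convergence treats the integral, and each
  finite sum is below the infinite one.\<close>

lemma nn_integral_count_space_le_infsum:
  fixes f :: "'a::countable \<Rightarrow> ennreal"
  shows "(\<integral>\<^sup>+ a. f a \<partial>count_space UNIV) \<le> (\<Sum>\<^sub>\<infinity>a. f a)"
proof -
  define F where "F n = {a :: 'a. to_nat a < n}" for n
  have fin: "finite (F n)" for n
    unfolding F_def by (rule finite_imageD[of to_nat]) (auto intro: finite_subset[of _ "{..<n}"] inj_on_subset)
  have "(\<integral>\<^sup>+ a. f a \<partial>count_space UNIV) = (\<integral>\<^sup>+ a. (SUP n. f a * indicator (F n) a) \<partial>count_space UNIV)"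
  proof (rule nn_integral_cong)
    fix a
    show "f a = (SUP n. f a * indicator (F n) a)"
    proof (rule antisym)
      show "f a \<le> (SUP n. f a * indicator (F n) a)"
        by (rule SUP_upper2[of "Suc (to_nat a)"]) (auto simp: F_def)
      show "(SUP n. f a * indicator (F n) a) \<le> f a"
        by (rule SUP_least) (auto simp: indicator_def)
    qed
  qed
  also have "\<dots> = (SUP n. \<integral>\<^sup>+ a. f a * indicator (F n) a \<partial>count_space UNIV)"
    by (intro nn_integral_monotone_convergence_SUP)
       (auto simp: incseq_def le_fun_def F_def indicator_def)
  also have "\<dots> \<le> (\<Sum>\<^sub>\<infinity>a. f a)"
  proof (rule SUP_least)
    fix n
    have "(\<integral>\<^sup>+ a. f a * indicator (F n) a \<partial>count_space UNIV) = (\<integral>\<^sup>+ a. f a \<partial>count_space (F n))"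
      by (simp add: nn_integral_count_space_indicator)
    also have "\<dots> = sum f (F n)" by (rule nn_integral_count_space_finite[OF fin])
    also have "\<dots> \<le> (\<Sum>\<^sub>\<infinity>a. f a)"
      using fin by (subst nonneg_infsum_complete) (auto intro!: SUP_upper)
    finally show "(\<integral>\<^sup>+ a. f a * indicator (F n) a \<partial>count_space UNIV) \<le> (\<Sum>\<^sub>\<infinity>a. f a)" .
  qed
  finally show ?thesis .
qed

lemma (in cells) cell_norm_cmult:
  assumes r: "0 < r" and c: "0 < c" and [measurable]: "F \<in> borel_measurable M" and F: "\<And>x. 0 \<le> F x"
  shows "cell_norm r (\<lambda>x. c * F x) = ennreal c * cell_norm r F"
proof -
  have "cell_int (\<lambda>x. ennreal ((c * F x) powr r)) a = ennreal (c powr r) * cell_int (\<lambda>x. ennreal (F x powr r)) a" for a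
  proof -
    have "cell_int (\<lambda>x. ennreal ((c * F x) powr r)) a = cell_int (\<lambda>x. ennreal (c powr r) * ennreal (F x powr r)) a"
      using c F by (intro cell_int_cong) (simp add: powr_mult flip: ennreal_mult)
    then show ?thesis by (simp add: cell_int_cmult)
  qed
  then show ?thesis
    using r c by (simp add: cell_norm_def ennreal_powr_cmult powr_powr nn_integral_cmult)
qed

lemma (in cells) cell_norm_AE_zero:
  assumes "0 < r" "AE x in M. F x = 0"
  shows "cell_norm r F = 0"
proof -
  have "cell_norm r F \<le> cell_norm r (\<lambda>_. 0)"
    using assms(2) by (intro cell_norm_mono_AE assms(1)) auto
  also have "\<dots> = 0"
    using assms(1) by (simp add: cell_norm_def cell_int_const ennreal_powr_def)
  finally show ?thesis by simp
qed

text \<open>On the cube of \<open>a\<close> the function \<open>lam \<circ> cube_index\<close> is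
  constantly \<open>lam a\<close>. This moves the weights from the norm into the function.\<close>

lemma Lp_norm_cube:
  fixes f :: "real ^ 'n::finite \<Rightarrow> complex"
  assumes [measurable]: "f \<in> borel_measurable lebesgue" and p: "0 < p"
  shows "Lp_norm p (complex_of_real (lam a) *\<^sub>C (chi a * abs_L0 f)) =
    ennreal_powr (cells.cell_int lebesgue cube_index
      (\<lambda>x. ennreal (norm (complex_of_real (lam (cube_index x)) * f x) powr p)) a) (1 / p)"
proof -
  interpret cells "lebesgue :: (real ^ 'n) measure" cube_index by (rule cells_lebesgue)
  have [measurable]: "(\<lambda>x. indicator (unit_cube a) x :: complex) \<in> borel_measurable lebesgue"
    using unit_cube_measurable by (intro borel_measurable_indicator)
  have "complex_of_real (lam a) *\<^sub>C (chi a * abs_L0 f) =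
      abs_L0 (\<lambda>x. complex_of_real (lam a) * (indicator (unit_cube a) x * f x))"
    unfolding chi_def by (simp add: times_abs_L0 scaleC_abs_L0)
  then have "Lp_norm p (complex_of_real (lam a) *\<^sub>C (chi a * abs_L0 f)) =
     ennreal_powr (\<integral>\<^sup>+ x. ennreal (norm (complex_of_real (lam a) * (indicator (unit_cube a) x * f x)) powr p) \<partial>lebesgue) (1 / p)"
    by (simp add: Lp_norm_abs_L0)
  also have "(\<integral>\<^sup>+ x. ennreal (norm (complex_of_real (lam a) * (indicator (unit_cube a) x * f x)) powr p) \<partial>lebesgue) =
     cell_int (\<lambda>x. ennreal (norm (complex_of_real (lam (cube_index x)) * f x) powr p)) a"
    unfolding cell_int_def using p
    by (intro nn_integral_cong) (auto simp: indicator_def cube_index_eq_iff cube_index_eq_iff[THEN iffD2])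
  finally show ?thesis .
qed

lemma ennreal_powr_square:
  assumes "0 < s" shows "(ennreal_powr t s)\<^sup>2 = ennreal_powr t (2 * s)"
proof (cases t)
  case (real x)
  have "(x powr s)\<^sup>2 = x powr (s + s)" by (simp only: power2_eq_square powr_add)
  then show ?thesis
    using real by (simp add: ennreal_powr_ennreal ennreal_power)
qed (simp add: power2_eq_square)

text \<open>For the squared modulus the cell norm of order \<open>p / 2\<close> is at most the sum
  inside \<open>l2_Lp_norm\<close>. On the unit ball the outer square root disappears, as both
  quantities are compared with \<open>1\<close>.\<close>

lemma cell_norm_le_l2_Lp_norm:
  fixes f :: "real ^ 'n::finite \<Rightarrow> complex"
  assumes [measurable]: "f \<in> borel_measurable lebesgue" and p: "0 < p"
    and le: "l2_Lp_norm lam p (abs_L0 f) \<le> 1"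
  shows "cells.cell_norm lebesgue cube_index (p / 2)
    (\<lambda>x. (norm (complex_of_real (lam (cube_index x)) * f x))\<^sup>2) \<le> 1"
proof -
  interpret cells "lebesgue :: (real ^ 'n) measure" cube_index by (rule cells_lebesgue)
  let ?S = "\<Sum>\<^sub>\<infinity>a. (Lp_norm p (complex_of_real (lam a) *\<^sub>C (chi a * abs_L0 f)))\<^sup>2"
  have sq: "t\<^sup>2 powr (p / 2) = t powr p" if "0 \<le> t" for t :: real
    using that by (cases "t = 0") (auto simp: powr_powr simp flip: powr_numeral)
  have "cell_norm (p / 2) (\<lambda>x. (norm (complex_of_real (lam (cube_index x)) * f x))\<^sup>2) =
     (\<integral>\<^sup>+ a. (Lp_norm p (complex_of_real (lam a) *\<^sub>C (chi a * abs_L0 f)))\<^sup>2 \<partial>count_space UNIV)"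
    unfolding cell_norm_def Lp_norm_cube[OF assms(1) p]
    using p by (simp add: sq ennreal_powr_square)
  also have "\<dots> \<le> ?S" by (rule nn_integral_count_space_le_infsum)
  also have "\<dots> \<le> 1"
  proof (cases ?S)
    case (real s)
    have "s powr (1 / 2) \<le> 1"
      using le real by (simp add: l2_Lp_norm_def ennreal_powr_ennreal)
    then have "s \<le> 1" using real(1) by (simp add: powr_half_sqrt)
    then show ?thesis using real by simp
  next
    case top
    then show ?thesis using le by (simp add: l2_Lp_norm_def top_unique)
  qed
  finally show ?thesis .
qed

theorem theorem9p7:
  fixes p q :: real
    and lam :: "int ^ 'n::finite \<Rightarrow> real"
    and T :: "'h::chilbert_space \<Rightarrow> 'n L0"
  assumes "1 < p" and "p < 2"
    and "1 / p = 1 / 2 + 1 / q"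
    and "\<And>a. 0 < lam a"
    and "continuous_linear_map (l2_Lp_norm lam p) T"
  shows "\<exists>(R :: 'h \<Rightarrow> 'n L0) g.
           continuous_linear_map (Lp_norm 2) R \<and>
           g \<in> finite_norm_space (linf_Lp_norm lam q) \<and> nonneg_L0 g \<and>
           T = (\<lambda>f. g * f) \<circ> R"
proof -
  interpret cells "lebesgue :: (real ^ 'n) measure" cube_index by (rule cells_lebesgue)
  \<comment> \<open>The exponent for squared moduli: \<open>1 < p < 2\<close> becomes
    \<open>1 / 2 < r < 1\<close>, and the relation between \<open>p\<close> and \<open>q\<close>
    becomes \<open>q = 2 * r / (1 - r)\<close>.\<close>
  define r where "r = p / 2"
  have r: "1 / 2 < r" "r < 1" "0 < r" using assms(1,2) by (auto simp: r_def)
  have q: "2 * r / (1 - r) = q" "0 < q"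
  proof -
    have "1 / q = (1 - r) / (2 * r)"
      using assms(1-3) by (simp add: r_def field_simps)
    then have "q = 2 * r / (1 - r)"
      by (metis inverse_divide inverse_eq_divide inverse_inverse_eq)
    then show "2 * r / (1 - r) = q" "0 < q" using r by auto
  qed
  have lin: "Vector_Spaces.linear scaleC scaleC T"
    and cont: "((\<lambda>v. l2_Lp_norm lam p (T v - T 0)) \<longlongrightarrow> 0) (at 0)"
    using assms(5) by (auto simp: continuous_linear_map_def)
  have T_add: "T (u + v) = T u + T v" and T_scale: "T (c *\<^sub>C u) = c *\<^sub>C T u" for u v c
    using lin by (auto simp: Vector_Spaces.linear_iff)
  have T0: "T 0 = 0" using T_add[of 0 0] by simp
  define Lam where "Lam x = lam (cube_index x)" for x :: "real ^ 'n"
  have Lam_meas [measurable]: "Lam \<in> borel_measurable lebesgue" unfolding Lam_def by measurable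
  have Lam_pos: "0 < Lam x" for x by (simp add: Lam_def assms(4))
  \<comment> \<open>A representative of \<open>T f\<close> with the weights multiplied in, so that
    unweighted cell norms apply.\<close>
  define X where "X f x = complex_of_real (Lam x) * rep_L0 (T f) x" for f x
  have X_meas [measurable]: "X f \<in> borel_measurable lebesgue" for f unfolding X_def by measurable
  have X_add: "AE x in lebesgue. X (u + v) x = X u x + X v x" for u v
    using rep_L0_add[of "T u" "T v"]
    by eventually_elim (simp add: X_def T_add distrib_left)
  have X_scale: "AE x in lebesgue. X (c *\<^sub>R u) x = c *\<^sub>R X u x" for c u
    using rep_L0_scaleC[of "complex_of_real c" "T u"]
    by eventually_elim (simp add: X_def T_scale scaleR_scaleC scaleR_conv_of_real)
  \<comment> \<open>Continuity at \<open>0\<close> is used in the form of a radius. The filter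
    \<open>at 0\<close> omits the point itself, hence the condition
    \<open>v \<noteq> 0\<close>.\<close>
  obtain \<delta> where \<delta>: "0 < \<delta>" "\<And>v. v \<noteq> 0 \<Longrightarrow> norm v < \<delta> \<Longrightarrow> l2_Lp_norm lam p (T v) < 1"
  proof -
    have "eventually (\<lambda>v. l2_Lp_norm lam p (T v - T 0) < 1) (at 0)"
      using order_tendstoD(2)[OF cont, of 1] by simp
    then show ?thesis using that by (auto simp: eventually_at T0)
  qed
  \<comment> \<open>A vector \<open>u \<noteq> 0\<close> is rescaled to norm
    \<open>\<delta> / 2\<close>, inside the ball just found; the squared scaling factor is
    \<open>B * (norm u)\<^sup>2\<close>.\<close>
  define B where "B = 4 / \<delta>\<^sup>2"
  have B: "cell_norm r (\<lambda>x. (norm (X u x))\<^sup>2) \<le> ennreal (B * (norm u)\<^sup>2)" for u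
  proof (cases "u = 0")
    case True
    have "AE x in lebesgue. (norm (X 0 x))\<^sup>2 = 0"
      using X_scale[of 0 0] by eventually_elim simp
    then show ?thesis
      unfolding True using r by (simp add: cell_norm_AE_zero)
  next
    case False
    define c where "c = 2 * norm u / \<delta>"
    have c: "0 < c" using False \<delta> by (simp add: c_def)
    define v where "v = (1 / c) *\<^sub>R u"
    have u: "u = c *\<^sub>R v" using c by (simp add: v_def)
    have v: "v \<noteq> 0" "norm v < \<delta>"
      using False \<delta> c by (auto simp: v_def c_def)
    have "cell_norm r (\<lambda>x. (norm (X u x))\<^sup>2) \<le> cell_norm r (\<lambda>x. c\<^sup>2 * (norm (X v x))\<^sup>2)"
    proof (rule cell_norm_mono_AE[OF r(3)])
      show "AE x in lebesgue. 0 \<le> (norm (X u x))\<^sup>2 \<and> (norm (X u x))\<^sup>2 \<le> c\<^sup>2 * (norm (X v x))\<^sup>2"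
        unfolding u using X_scale[of c v] by eventually_elim (simp add: power_mult_distrib norm_mult)
    qed
    also have "\<dots> = ennreal (c\<^sup>2) * cell_norm r (\<lambda>x. (norm (X v x))\<^sup>2)"
      using c by (intro cell_norm_cmult r) auto
    also have "\<dots> \<le> ennreal (c\<^sup>2) * 1"
    proof (intro mult_left_mono)
      show "cell_norm r (\<lambda>x. (norm (X v x))\<^sup>2) \<le> 1"
        unfolding r_def X_def Lam_def
        by (rule cell_norm_le_l2_Lp_norm)
           (use \<delta>(2)[OF v] assms(1) in \<open>auto simp: abs_rep_L0 less_imp_le\<close>)
    qed auto
    also have "\<dots> = ennreal (B * (norm u)\<^sup>2)"
      by (simp add: c_def B_def power_divide power_mult_distrib)
    finally show ?thesis .
  qed
  have "0 \<le> B" by (simp add: B_def)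
  obtain h C where h_meas [measurable]: "h \<in> borel_measurable lebesgue"
    and h: "\<And>x. 0 \<le> h x" "AE x in lebesgue. 0 < h x"
      "\<And>a. cell_int (\<lambda>x. ennreal (h x powr q)) a \<le> 1"
    and hC: "\<And>f. norm f \<le> 1 \<Longrightarrow> (\<integral>\<^sup>+ x. ennreal ((norm (X f x))\<^sup>2 / (h x)\<^sup>2) \<partial>lebesgue) \<le> ennreal C"
    using exists_multiplier[OF r(1,2) chilbert_parallelogram X_meas X_add X_scale \<open>0 \<le> B\<close> B]
    unfolding q(1) by blast
  define g where "g = abs_L0 (\<lambda>x. complex_of_real (h x / Lam x))"
  \<comment> \<open>With this factor \<open>R f\<close> is represented by \<open>X f / h\<close>.
    Where \<open>h\<close> vanishes the quotient is \<open>0\<close>; off this null set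
    \<open>g\<close> and \<open>g'\<close> are inverse to each other, which yields the
    factorization.\<close>
  define g' where "g' = abs_L0 (\<lambda>x. complex_of_real (Lam x / h x))"
  define R where "R f = g' * T f" for f
  have R_add: "R (u + v) = R u + R v" for u v by (simp add: R_def T_add distrib_left)
  have R_scale: "R (c *\<^sub>C u) = c *\<^sub>C R u" for c u by (simp add: R_def T_scale times_scaleC_L0)
  have R_diff: "R v - R u = R (v - u)" for u v using R_add[of "v - u" u] by simp
  have R_lin: "Vector_Spaces.linear scaleC scaleC R"
    using lin R_add R_scale by (auto simp: Vector_Spaces.linear_iff)
  have R_abs: "R f = abs_L0 (\<lambda>x. complex_of_real (Lam x / h x) * rep_L0 (T f) x)" for f
  proof -
    have "g' * abs_L0 (rep_L0 (T f)) = abs_L0 (\<lambda>x. complex_of_real (Lam x / h x) * rep_L0 (T f) x)"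
      unfolding g'_def by (rule times_abs_L0) measurable
    then show ?thesis by (simp add: R_def abs_rep_L0)
  qed
  \<comment> \<open>\<open>C\<close> comes without a sign, so its absolute value is taken before the
    root.\<close>
  define D where "D = sqrt \<bar>C\<bar>"
  have R_unit: "Lp_norm 2 (R f) \<le> ennreal D" if "norm f \<le> 1" for f
  proof -
    have "Lp_norm 2 (R f) = ennreal_powr (\<integral>\<^sup>+ x. ennreal (norm (complex_of_real (Lam x / h x) * rep_L0 (T f) x) powr 2) \<partial>lebesgue) (1 / 2)"
      unfolding R_abs by (rule Lp_norm_abs_L0) measurable
    also have "(\<integral>\<^sup>+ x. ennreal (norm (complex_of_real (Lam x / h x) * rep_L0 (T f) x) powr 2) \<partial>lebesgue) =
      (\<integral>\<^sup>+ x. ennreal ((norm (X f x))\<^sup>2 / (h x)\<^sup>2) \<partial>lebesgue)"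
      by (intro nn_integral_cong) (simp add: X_def norm_mult norm_divide power_mult_distrib power_divide)
    also have "ennreal_powr \<dots> (1 / 2) \<le> ennreal_powr (ennreal \<bar>C\<bar>) (1 / 2)"
      using hC[OF that] by (intro ennreal_powr_mono) (auto intro: order.trans[OF _ ennreal_leI])
    also have "\<dots> = ennreal D"
      by (simp add: ennreal_powr_ennreal D_def powr_half_sqrt)
    finally show ?thesis .
  qed
  have R_bound: "Lp_norm 2 (R f) \<le> ennreal (D * norm f)" for f
  proof (cases "f = 0")
    case True
    have "R 0 = 0" by (simp add: R_def T0)
    also have "(0 :: 'n L0) = abs_L0 (\<lambda>_. 0)" by (simp add: zero_L0_def)
    finally have "Lp_norm 2 (R 0) = 0"
      by (simp add: Lp_norm_abs_L0 ennreal_powr_def)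
    then show ?thesis by (simp add: True)
  next
    case False
    define v where "v = (1 / norm f) *\<^sub>R f"
    have "f = complex_of_real (norm f) *\<^sub>C v"
      using False by (simp add: v_def flip: scaleR_scaleC)
    then have "R f = complex_of_real (norm f) *\<^sub>C R v" by (metis R_scale)
    then have "Lp_norm 2 (R f) = ennreal (norm f) * Lp_norm 2 (R v)"
      using False Lp_norm_scaleC[of 2 "complex_of_real (norm f)" "R v"] by simp
    also have "\<dots> \<le> ennreal (norm f) * ennreal D"
      by (intro mult_left_mono R_unit) (auto simp: v_def)
    also have "\<dots> = ennreal (D * norm f)"
      by (simp add: D_def mult.commute flip: ennreal_mult)
    finally show ?thesis .
  qed
  have "continuous_linear_map (Lp_norm 2) R"
    unfolding continuous_linear_map_def
  proof (intro conjI allI R_lin)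
    show "range R \<subseteq> finite_norm_space (Lp_norm 2)"
      by (auto simp: finite_norm_space_def intro!: le_less_trans[OF R_bound])
    show "((\<lambda>v. Lp_norm 2 (R v - R u)) \<longlongrightarrow> 0) (at u)" for u
    proof (rule tendsto_sandwich[where f = "\<lambda>_. 0" and h = "\<lambda>v. ennreal (D * norm (v - u))"])
      have "((\<lambda>v. D * norm (v - u)) \<longlongrightarrow> D * norm (u - u)) (at u)"
        by (intro tendsto_intros)
      then show "((\<lambda>v. ennreal (D * norm (v - u))) \<longlongrightarrow> 0) (at u)"
        using tendsto_ennrealI by fastforce
    qed (auto simp: R_diff R_bound)
  qed
  moreover have "g \<in> finite_norm_space (linf_Lp_norm lam q)"
  proof -
    have "Lp_norm q (complex_of_real (lam a) *\<^sub>C (chi a * g)) \<le> 1" for a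
    proof -
      have "Lp_norm q (complex_of_real (lam a) *\<^sub>C (chi a * g)) =
         ennreal_powr (cell_int (\<lambda>x. ennreal (norm (complex_of_real (lam (cube_index x)) * complex_of_real (h x / Lam x)) powr q)) a) (1 / q)"
        unfolding g_def by (rule Lp_norm_cube) (use q in measurable)
      also have "\<dots> = ennreal_powr (cell_int (\<lambda>x. ennreal (h x powr q)) a) (1 / q)"
      proof -
        have "norm (complex_of_real (lam (cube_index x)) * complex_of_real (h x / Lam x)) = h x" for x
          using Lam_pos[of x] h(1)[of x] by (simp add: Lam_def norm_mult norm_divide)
        then show ?thesis by simp
      qed
      also have "\<dots> \<le> ennreal_powr 1 (1 / q)"
        using q h by (intro ennreal_powr_mono) auto
      finally show ?thesis by (simp add: ennreal_powr_def)
    qed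
    then have "linf_Lp_norm lam q g \<le> 1"
      unfolding linf_Lp_norm_def by (rule SUP_least)
    then show ?thesis by (auto simp: finite_norm_space_def intro: le_less_trans)
  qed
  moreover have "nonneg_L0 g"
  proof -
    have "nonneg_L0 g \<longleftrightarrow> (AE x in lebesgue. complex_of_real (h x / Lam x) \<in> \<real>\<^sub>\<ge>\<^sub>0)"
      unfolding g_def by (rule nonneg_L0.abs_eq) (simp add: ae_eq_refl_iff)
    then show ?thesis
      using h(1) Lam_pos by (simp add: nonneg_Reals_of_real_iff less_imp_le del: of_real_divide)
  qed
  moreover have "T = (\<lambda>f. g * f) \<circ> R"
  proof
    fix f
    have "g * R f = abs_L0 (\<lambda>x. complex_of_real (h x / Lam x) * (complex_of_real (Lam x / h x) * rep_L0 (T f) x))"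
      unfolding g_def R_abs by (rule times_abs_L0) measurable
    also have "\<dots> = abs_L0 (rep_L0 (T f))"
    proof (rule abs_L0_eqI)
      show "AE x in lebesgue. complex_of_real (h x / Lam x) * (complex_of_real (Lam x / h x) * rep_L0 (T f) x) = rep_L0 (T f) x"
        using h(2)
      proof eventually_elim
        case (elim x)
        then show ?case using Lam_pos[of x] by simp
      qed
    qed measurable
    finally show "T f = ((\<lambda>f. g * f) \<circ> R) f" by (simp add: abs_rep_L0)
  qed
  ultimately show ?thesis by blast
qed

end
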